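(* Let $k=\mathbb{Q}(\sqrt2,u)$, where $u$ is an indeterminate, put $v=1-u$, and let $\alpha\in\{1,-1\}$. Then the elements $h_\alpha(u)$ and $h_\alpha(v)$ of $\mathrm{St}_2(k)$ overcommute and $$\mathrm{ocl}(h_\alpha(u),h_\alpha(v))\le25.$$
   Context: Notation: $[a,b]=aba^{-1}b^{-1}$. Steinberg group: $\mathrm{St}_2(k)=F/R$ where $F$ is the free group on the symbols $x_\alpha(t)$ with $\alpha\in\{1,-1\}$, $t\in k$, and $R$ is normally generated by $$x_\alpha(s+t)x_\alpha(s)^{-1}x_\alpha(t)^{-1}\ (s,t\in k),\qquad w_\alpha(c)x_\alpha(t)w_\alpha(c)^{-1}x_{-\alpha}(c^{-2}t)\ (c\in k^*,\ t\in k),$$ for $\alpha=\pm1$, where $w_\alpha(c)=x_\alpha(c)x_{-\alpha}(-c^{-1})x_\alpha(c)$. For $c\in k^*$ set $h_\alpha(c)=w_\alpha(c)w_\alpha(1)^{-1}$. Two commuting elements $g,h$ of a group $G$ overcommute if any lifts of $g,h$ to any central extension of $G$ commute; equivalently, for any extension $1\to R\to F\to G\to1$ with $F$ free and lifts $\tilde g,\tilde h\in F$, $[\tilde g,\tilde h]\in[F,R]$. Overcommutation length: for an overcommuting pair $g,h$ in $G=F/R$ ($F$ free), $\mathrm{ocl}(g,h)$ is the minimum, over all lifts $\tilde g,\tilde h\in F$ of $g,h$, of $$\min\Big\{n\in\mathbb{N}: [\tilde g,\tilde h]=\prod_{i=1}^n[f_i,r_i]^{\pm1}\text{ in }F,\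 f_i\in F,\ r_i\in R\Big\}.$$ It does not depend on the presentation $F/R$. *)

theory Defs
  imports
    "HOL-Computational_Algebra.Polynomial"
    "HOL-Computational_Algebra.Fraction_Field"
    "HOL-Algebra.Coset"
    "HOL-Library.Extended_Nat"
begin

section \<open>The field of rational functions in one variable over the rationals with a square root of 2\<close>

typedef qsqrt2 = "{a + b * sqrt 2 | a b. a \<in> \<rat> \<and> b \<in> \<rat>}"
  by (rule exI[of _ 0], rule CollectI, rule exI[of _ 0], rule exI[of _ 0]) simp

setup_lifting type_definition_qsqrt2

instantiation qsqrt2 :: "field"
begin

lift_definition zero_qsqrt2 :: qsqrt2 is 0
  by (rule exI[of _ 0], rule exI[of _ 0]) simp

lift_definition one_qsqrt2 :: qsqrt2 is 1
  by (rule exI[of _ 1], rule exI[of _ 0]) simp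

lift_definition plus_qsqrt2 :: "qsqrt2 \<Rightarrow> qsqrt2 \<Rightarrow> qsqrt2" is "(+)"
proof -
  fix x y :: real
  assume "\<exists>a b. x = a + b * sqrt 2 \<and> a \<in> \<rat> \<and> b \<in> \<rat>"
    and "\<exists>a b. y = a + b * sqrt 2 \<and> a \<in> \<rat> \<and> b \<in> \<rat>"
  then obtain a b c d where "x = a + b * sqrt 2" "y = c + d * sqrt 2"
    "a \<in> \<rat>" "b \<in> \<rat>" "c \<in> \<rat>" "d \<in> \<rat>" by blast
  then have "x + y = (a + c) + (b + d) * sqrt 2" "a + c \<in> \<rat>" "b + d \<in> \<rat>"
    by (auto simp: algebra_simps)
  then show "\<exists>a b. x + y = a + b * sqrt 2 \<and> a \<in> \<rat> \<and> b \<in> \<rat>" by blast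
qed

lift_definition uminus_qsqrt2 :: "qsqrt2 \<Rightarrow> qsqrt2" is uminus
proof -
  fix x :: real
  assume "\<exists>a b. x = a + b * sqrt 2 \<and> a \<in> \<rat> \<and> b \<in> \<rat>"
  then obtain a b where "x = a + b * sqrt 2" "a \<in> \<rat>" "b \<in> \<rat>" by blast
  then have "- x = (- a) + (- b) * sqrt 2" "- a \<in> \<rat>" "- b \<in> \<rat>" by auto
  then show "\<exists>a b. - x = a + b * sqrt 2 \<and> a \<in> \<rat> \<and> b \<in> \<rat>" by blast
qed

lift_definition times_qsqrt2 :: "qsqrt2 \<Rightarrow> qsqrt2 \<Rightarrow> qsqrt2" is "(*)"
proof -
  fix x y :: real
  assume "\<exists>a b. x = a + b * sqrt 2 \<and> a \<in> \<rat> \<and> b \<in> \<rat>"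
    and "\<exists>a b. y = a + b * sqrt 2 \<and> a \<in> \<rat> \<and> b \<in> \<rat>"
  then obtain a b c d where xy: "x = a + b * sqrt 2" "y = c + d * sqrt 2"
    and q: "a \<in> \<rat>" "b \<in> \<rat>" "c \<in> \<rat>" "d \<in> \<rat>" by blast
  have "x * y = a * c + b * d * (sqrt 2 * sqrt 2) + (a * d + b * c) * sqrt 2"
    unfolding xy by (simp only: algebra_simps)
  then have "x * y = (a * c + 2 * b * d) + (a * d + b * c) * sqrt 2" by simp
  moreover have "a * c + 2 * b * d \<in> \<rat>" "a * d + b * c \<in> \<rat>" using q by auto
  ultimately show "\<exists>a b. x * y = a + b * sqrt 2 \<and> a \<in> \<rat> \<and> b \<in> \<rat>" by blast
qed

lift_definition inverse_qsqrt2 :: "qsqrt2 \<Rightarrow> qsqrt2" is inverse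
proof -
  fix x :: real
  assume "\<exists>a b. x = a + b * sqrt 2 \<and> a \<in> \<rat> \<and> b \<in> \<rat>"
  then obtain a b where x: "x = a + b * sqrt 2" and q: "a \<in> \<rat>" "b \<in> \<rat>" by blast
  show "\<exists>a b. inverse x = a + b * sqrt 2 \<and> a \<in> \<rat> \<and> b \<in> \<rat>"
  proof (cases "a - b * sqrt 2 = 0")
    case True
    then have "inverse x = inverse (2 * a) + 0 * sqrt 2" unfolding x by simp
    moreover have "inverse (2 * a) \<in> \<rat>" using q by auto
    ultimately show ?thesis using Rats_0 by blast
  next
    case False
    define n where "n = a * a - 2 * b * b"
    have n: "x * (a - b * sqrt 2) = n"
      unfolding x n_def by (simp add: algebra_simps)
    have "n \<in> \<rat>" unfolding n_def using q by auto
    have "inverse x = (a - b * sqrt 2) / n"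
      unfolding n[symmetric] using False by (cases "x = 0") (auto simp: field_simps)
    then have "inverse x = a / n + (- b / n) * sqrt 2" by (simp add: diff_divide_distrib)
    moreover have "a / n \<in> \<rat>" "- b / n \<in> \<rat>" using q \<open>n \<in> \<rat>\<close> by auto
    ultimately show ?thesis by blast
  qed
qed

definition minus_qsqrt2 :: "qsqrt2 \<Rightarrow> qsqrt2 \<Rightarrow> qsqrt2" where
  "minus_qsqrt2 x y = x + - y"

definition divide_qsqrt2 :: "qsqrt2 \<Rightarrow> qsqrt2 \<Rightarrow> qsqrt2" where
  "divide_qsqrt2 x y = x * inverse y"

instance
proof
  fix x y z :: qsqrt2
  show "x + y + z = x + (y + z)" by transfer (simp add: algebra_simps)
  show "x + y = y + x" by transfer (simp add: algebra_simps)
  show "0 + x = x" by transfer simp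
  show "- x + x = 0" by transfer simp
  show "x - y = x + - y" by (simp add: minus_qsqrt2_def)
  show "x * y * z = x * (y * z)" by transfer (simp add: algebra_simps)
  show "x * y = y * x" by transfer (simp add: algebra_simps)
  show "1 * x = x" by transfer simp
  show "(x + y) * z = x * z + y * z" by transfer (simp add: algebra_simps)
  show "(0::qsqrt2) \<noteq> 1" by transfer simp
  show "x \<noteq> 0 \<Longrightarrow> inverse x * x = 1" by transfer simp
  show "x div y = x * inverse y" by (simp add: divide_qsqrt2_def)
  show "inverse (0::qsqrt2) = 0" by transfer simp
qed

end

type_synonym ratfun = "qsqrt2 poly fract"

definition indet :: ratfun where
  "indet = Fract [:0, 1:] 1"


section \<open>Free groups\<close>

text \<open>A letter is a generator together with a sign, True standing for the
  generator itself and False for its formal inverse.  Elements are the freely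
  reduced words; the word \<open>push x ws\<close> is the reduced form of \<open>x # ws\<close> when
  \<open>ws\<close> is reduced.\<close>

type_synonym 'a word = "('a \<times> bool) list"

definition inv_letter :: "'a \<times> bool \<Rightarrow> 'a \<times> bool" where
  "inv_letter x = (fst x, \<not> snd x)"

fun push :: "'a \<times> bool \<Rightarrow> 'a word \<Rightarrow> 'a word" where
  "push x [] = [x]"
| "push x (y # ys) = (if y = inv_letter x then ys else x # y # ys)"

definition reduced :: "'a word \<Rightarrow> bool" where
  "reduced = successively (\<lambda>x y. y \<noteq> inv_letter x)"

definition free_group :: "'a set \<Rightarrow> 'a word monoid" where
  "free_group S = \<lparr>carrier = {ws. reduced ws \<and> fst ` set ws \<subseteq> S},
     mult = (\<lambda>xs ys. foldr push xs ys), one = []\<rparr>"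

lemma inv_letter_inv_letter [simp]: "inv_letter (inv_letter x) = x"
  by (simp add: inv_letter_def)

lemma fst_inv_letter [simp]: "fst (inv_letter x) = fst x"
  by (simp add: inv_letter_def)

lemma inv_letter_eq_iff: "x = inv_letter y \<longleftrightarrow> y = inv_letter x"
  by (metis inv_letter_inv_letter)

lemma reduced_Nil [simp]: "reduced []"
  by (simp add: reduced_def)

lemma reduced_Cons: "reduced (x # xs) \<longleftrightarrow> xs = [] \<or> hd xs \<noteq> inv_letter x \<and> reduced xs"
  by (auto simp: reduced_def successively_Cons)

lemma reduced_push: "reduced ws \<Longrightarrow> reduced (push x ws)"
  by (cases ws) (auto simp: reduced_Cons)

lemma reduced_foldr_push: "reduced ys \<Longrightarrow> reduced (foldr push xs ys)"
  by (induction xs) (auto intro: reduced_push)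

lemma set_push: "fst ` set (push x ws) \<subseteq> insert (fst x) (fst ` set ws)"
  by (cases ws) auto

lemma set_foldr_push: "fst ` set (foldr push xs ys) \<subseteq> fst ` set xs \<union> fst ` set ys"
proof (induction xs)
  case (Cons x xs)
  have "fst ` set (foldr push (x # xs) ys) \<subseteq> insert (fst x) (fst ` set (foldr push xs ys))"
    using set_push[of x "foldr push xs ys"] by simp
  also have "\<dots> \<subseteq> insert (fst x) (fst ` set xs \<union> fst ` set ys)"
    using Cons by (rule insert_mono)
  also have "\<dots> = fst ` set (x # xs) \<union> fst ` set ys" by simp
  finally show ?case .
qed simp

lemma push_push_inv: "reduced ws \<Longrightarrow> push x (push (inv_letter x) ws) = ws"
  by (cases ws rule: remdups_adj.cases) (auto simp: reduced_Cons inv_letter_eq_iff[of x])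

lemma foldr_push_push:
  assumes "reduced zs"
  shows "foldr push (push x ys) zs = push x (foldr push ys zs)"
  using push_push_inv[OF reduced_foldr_push[OF assms]] by (cases ys) auto

lemma foldr_push_assoc:
  assumes "reduced zs"
  shows "foldr push (foldr push xs ys) zs = foldr push xs (foldr push ys zs)"
  by (induction xs) (auto simp: foldr_push_push[OF assms])

lemma foldr_push_Nil: "reduced xs \<Longrightarrow> foldr push xs [] = xs"
proof (induction xs)
  case (Cons x xs)
  then show ?case by (cases xs) (auto simp: reduced_Cons)
qed simp

lemma reduced_rev_inv: "reduced ws \<Longrightarrow> reduced (rev (map inv_letter ws))"
  unfolding reduced_def
  by (simp add: successively_map) (erule successively_mono, metis inv_letter_inv_letter)

lemma foldr_push_rev_inv:
  assumes "reduced zs"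
  shows "foldr push (rev (map inv_letter ws)) (foldr push ws zs) = zs"
proof (induction ws)
  case (Cons w ws)
  have "push (inv_letter w) (push w (foldr push ws zs)) = foldr push ws zs"
    using push_push_inv[OF reduced_foldr_push[OF assms], of "inv_letter w" ws] by simp
  then show ?case using Cons by simp
qed simp

lemma group_free_group: "group (free_group S)"
proof (rule groupI)
  fix x y assume "x \<in> carrier (free_group S)" "y \<in> carrier (free_group S)"
  then show "x \<otimes>\<^bsub>free_group S\<^esub> y \<in> carrier (free_group S)"
    using order_trans[OF set_foldr_push[of x y]]
    by (simp add: free_group_def reduced_foldr_push)
next
  fix x assume x: "x \<in> carrier (free_group S)"
  show "\<exists>y\<in>carrier (free_group S). y \<otimes>\<^bsub>free_group S\<^esub> x = \<one>\<^bsub>free_group S\<^esub>"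
  proof (rule bexI[of _ "rev (map inv_letter x)"])
    show "rev (map inv_letter x) \<otimes>\<^bsub>free_group S\<^esub> x = \<one>\<^bsub>free_group S\<^esub>"
      using x foldr_push_rev_inv[of "[]" x] foldr_push_Nil[of x] by (simp add: free_group_def)
    show "rev (map inv_letter x) \<in> carrier (free_group S)"
      using x by (auto simp: free_group_def reduced_rev_inv)
  qed
qed (auto simp: free_group_def foldr_push_assoc)

lemma generator_in_free_group: "a \<in> S \<Longrightarrow> [(a, True)] \<in> carrier (free_group S)"
  by (simp add: free_group_def reduced_Cons)

lemma free_group_hom_exists:
  assumes "group G" and f: "f \<in> S \<rightarrow> carrier G"
  shows "\<exists>\<phi>\<in>hom (free_group S) G. \<forall>a\<in>S. \<phi> [(a, True)] = f a"
proof -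
  interpret group G by fact
  define l where "l x = (if snd x then f (fst x) else inv\<^bsub>G\<^esub> f (fst x))" for x
  define \<phi> where "\<phi> ws = foldr (\<lambda>x g. l x \<otimes>\<^bsub>G\<^esub> g) ws \<one>\<^bsub>G\<^esub>" for ws
  have l_in: "l x \<in> carrier G" if "fst x \<in> S" for x
    using f that by (auto simp: l_def)
  have l_inv: "l x \<otimes>\<^bsub>G\<^esub> (l (inv_letter x) \<otimes>\<^bsub>G\<^esub> g) = g" if "fst x \<in> S" "g \<in> carrier G" for x g
    using f that by (auto simp: l_def inv_letter_def m_assoc[symmetric] Pi_iff)
  have \<phi>_in: "\<phi> ws \<in> carrier G" if "fst ` set ws \<subseteq> S" for ws
    using that by (induction ws) (auto simp: \<phi>_def intro!: m_closed l_in)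
  have \<phi>_push: "\<phi> (push x ws) = l x \<otimes>\<^bsub>G\<^esub> \<phi> ws" if "fst x \<in> S" "fst ` set ws \<subseteq> S" for x ws
  proof (cases ws)
    case (Cons y ys)
    then show ?thesis using that l_inv[of x "\<phi> ys"] \<phi>_in[of ys] by (auto simp: \<phi>_def)
  qed (simp add: \<phi>_def)
  have \<phi>_mult: "\<phi> (foldr push xs ys) = \<phi> xs \<otimes>\<^bsub>G\<^esub> \<phi> ys"
    if "fst ` set xs \<subseteq> S" "fst ` set ys \<subseteq> S" for xs ys
    using that(1)
  proof (induction xs)
    case Nil
    show ?case using \<phi>_in[OF that(2)] by (simp add: \<phi>_def)
  next
    case (Cons x xs)
    have xs: "fst x \<in> S" "fst ` set xs \<subseteq> S" using Cons.prems by auto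
    have sub: "fst ` set (foldr push xs ys) \<subseteq> S"
      using order_trans[OF set_foldr_push[of xs ys]] xs that(2) by simp
    have "\<phi> (foldr push (x # xs) ys) = l x \<otimes>\<^bsub>G\<^esub> (\<phi> xs \<otimes>\<^bsub>G\<^esub> \<phi> ys)"
      using \<phi>_push[OF xs(1) sub] Cons.IH[OF xs(2)] by simp
    also have "\<dots> = (l x \<otimes>\<^bsub>G\<^esub> \<phi> xs) \<otimes>\<^bsub>G\<^esub> \<phi> ys"
      using m_assoc l_in[OF xs(1)] \<phi>_in[OF xs(2)] \<phi>_in[OF that(2)] by simp
    also have "l x \<otimes>\<^bsub>G\<^esub> \<phi> xs = \<phi> (x # xs)" by (simp add: \<phi>_def)
    finally show ?case .
  qed
  have "\<phi> \<in> hom (free_group S) G"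
    by (rule homI) (simp_all add: free_group_def \<phi>_in \<phi>_mult)
  moreover have "\<forall>a\<in>S. \<phi> [(a, True)] = f a"
    using f by (auto simp: \<phi>_def l_def Pi_iff)
  ultimately show ?thesis by blast
qed


section \<open>Presentations, overcommutation and overcommutation length\<close>

definition commutator :: "('g, 'm) monoid_scheme \<Rightarrow> 'g \<Rightarrow> 'g \<Rightarrow> 'g" where
  "commutator G a b = a \<otimes>\<^bsub>G\<^esub> b \<otimes>\<^bsub>G\<^esub> inv\<^bsub>G\<^esub> a \<otimes>\<^bsub>G\<^esub> inv\<^bsub>G\<^esub> b"

definition normal_closure :: "('g, 'm) monoid_scheme \<Rightarrow> 'g set \<Rightarrow> 'g set" where
  "normal_closure G X = \<Inter>{N. N \<lhd> G \<and> X \<subseteq> N}"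

lemma (in group) normal_closure_normal:
  assumes "X \<subseteq> carrier G"
  shows "normal_closure G X \<lhd> G"
proof -
  have "carrier G \<lhd> G" by (simp add: normal_inv_iff subgroup_self)
  then have ne: "{N. N \<lhd> G \<and> X \<subseteq> N} \<noteq> {}" using assms by blast
  then have "subgroup (normal_closure G X) G"
    unfolding normal_closure_def by (intro subgroups_Inter) (auto dest: normal_imp_subgroup)
  then show ?thesis
    by (auto simp: normal_inv_iff normal_closure_def)
qed

definition central_extension ::
    "('e, 'm) monoid_scheme \<Rightarrow> ('g, 'n) monoid_scheme \<Rightarrow> ('e \<Rightarrow> 'g) \<Rightarrow> bool" where
  "central_extension E G p \<longleftrightarrow> group E \<and> group G \<and> p \<in> epi E G \<and>
     (\<forall>z\<in>kernel E G p. \<forall>e\<in>carrier E. z \<otimes>\<^bsub>E\<^esub> e = e \<otimes>\<^bsub>E\<^esub> z)"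

text \<open>HOL cannot quantify over types inside a formula, so the type of the elements
  of the extensions is a parameter; a theorem about \<open>overcommute TYPE('e)\<close> with
  \<open>'e\<close> a type variable speaks about all central extensions.\<close>

definition overcommute :: "'e itself \<Rightarrow> ('g, 'm) monoid_scheme \<Rightarrow> 'g \<Rightarrow> 'g \<Rightarrow> bool" where
  "overcommute T G g h \<longleftrightarrow> g \<in> carrier G \<and> h \<in> carrier G \<and> g \<otimes>\<^bsub>G\<^esub> h = h \<otimes>\<^bsub>G\<^esub> g \<and>
     (\<forall>(E :: 'e monoid) p. central_extension E G p \<longrightarrow>
        (\<forall>a\<in>carrier E. \<forall>b\<in>carrier E. p a = g \<longrightarrow> p b = h \<longrightarrow> a \<otimes>\<^bsub>E\<^esub> b = b \<otimes>\<^bsub>E\<^esub> a))"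

definition FR_commutators :: "('g, 'm) monoid_scheme \<Rightarrow> 'g set \<Rightarrow> 'g set" where
  "FR_commutators F R =
     {c. \<exists>f\<in>carrier F. \<exists>r\<in>R. c = commutator F f r \<or> c = inv\<^bsub>F\<^esub> (commutator F f r)}"

text \<open>The overcommutation length of two elements of \<open>F Mod R\<close>, where \<open>F\<close> is free.  These
  elements are cosets, and their lifts to \<open>F\<close> are their members.  The value is
  \<open>\<infinity>\<close> when no lifts have a commutator that is a product of the required form.\<close>

definition ocl :: "('g, 'm) monoid_scheme \<Rightarrow> 'g set \<Rightarrow> 'g set \<Rightarrow> 'g set \<Rightarrow> enat" where
  "ocl F R g h = (INF a\<in>g. INF b\<in>h.
     Inf {enat n | n. \<exists>cs. length cs = n \<and> set cs \<subseteq> FR_commutators F R \<and>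
                           commutator F a b = foldr (mult F) cs \<one>\<^bsub>F\<^esub>})"


section \<open>The Steinberg group\<close>

text \<open>The symbol \<open>x\<^sub>\<alpha>(t)\<close> is the pair \<open>(\<alpha>, t)\<close> with \<open>\<alpha> \<in> {1, -1}\<close>.\<close>

definition steinberg_free :: "(int \<times> 'k::field) word monoid" where
  "steinberg_free = free_group ({1, -1} \<times> UNIV)"

definition x_word :: "int \<Rightarrow> 'k::field \<Rightarrow> (int \<times> 'k) word" where
  "x_word \<alpha> t = [((\<alpha>, t), True)]"

definition w_word :: "int \<Rightarrow> 'k::field \<Rightarrow> (int \<times> 'k) word" where
  "w_word \<alpha> c = x_word \<alpha> c \<otimes>\<^bsub>steinberg_free\<^esub> x_word (- \<alpha>) (- inverse c)
     \<otimes>\<^bsub>steinberg_free\<^esub> x_word \<alpha> c"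

definition h_word :: "int \<Rightarrow> 'k::field \<Rightarrow> (int \<times> 'k) word" where
  "h_word \<alpha> c = w_word \<alpha> c \<otimes>\<^bsub>steinberg_free\<^esub> inv\<^bsub>steinberg_free\<^esub> (w_word \<alpha> 1)"

definition steinberg_relators :: "(int \<times> 'k::field) word set" where
  "steinberg_relators =
     {x_word \<alpha> (s + t) \<otimes>\<^bsub>steinberg_free\<^esub> inv\<^bsub>steinberg_free\<^esub> (x_word \<alpha> s)
        \<otimes>\<^bsub>steinberg_free\<^esub> inv\<^bsub>steinberg_free\<^esub> (x_word \<alpha> t) | \<alpha> s t. \<alpha> \<in> {1, -1}} \<union>
     {w_word \<alpha> c \<otimes>\<^bsub>steinberg_free\<^esub> x_word \<alpha> t \<otimes>\<^bsub>steinberg_free\<^esub> inv\<^bsub>steinberg_free\<^esub> (w_word \<alpha> c)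
        \<otimes>\<^bsub>steinberg_free\<^esub> x_word (- \<alpha>) (inverse (c\<^sup>2) * t) | \<alpha> c t. \<alpha> \<in> {1, -1} \<and> c \<noteq> 0}"

definition steinberg_R :: "(int \<times> 'k::field) word set" where
  "steinberg_R = normal_closure steinberg_free steinberg_relators"

definition St2 :: "(int \<times> 'k::field) word set monoid" where
  "St2 = steinberg_free Mod steinberg_R"

definition h_elt :: "int \<Rightarrow> 'k::field \<Rightarrow> (int \<times> 'k) word set" where
  "h_elt \<alpha> c = steinberg_R #>\<^bsub>steinberg_free\<^esub> h_word \<alpha> c"

lemma steinberg_word_closed:
  assumes "\<alpha> \<in> {1, -1}"
  shows "x_word \<alpha> t \<in> carrier steinberg_free" "w_word \<alpha> c \<in> carrier steinberg_free"
    "h_word \<alpha> c \<in> carrier steinberg_free"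
proof -
  interpret group steinberg_free
    by (simp add: steinberg_free_def group_free_group)
  have x: "x_word \<beta> t \<in> carrier steinberg_free" if "\<beta> \<in> {1, -1}" for \<beta> t
    using that generator_in_free_group[of "(\<beta>, t)" "{1, -1} \<times> UNIV"]
    by (simp add: x_word_def steinberg_free_def)
  have w: "w_word \<alpha> c \<in> carrier steinberg_free" for c
    unfolding w_word_def using assms by (intro m_closed x) auto
  show "x_word \<alpha> t \<in> carrier steinberg_free" "w_word \<alpha> c \<in> carrier steinberg_free"
    "h_word \<alpha> c \<in> carrier steinberg_free"
    using x[OF assms] w by (auto simp: h_word_def intro!: m_closed inv_closed)
qed

lemma steinberg_R_normal: "steinberg_R \<lhd> steinberg_free"
proof -
  interpret group steinberg_free
    by (simp add: steinberg_free_def group_free_group)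
  have "steinberg_relators \<subseteq> carrier steinberg_free"
    unfolding steinberg_relators_def
    by (auto intro!: m_closed inv_closed steinberg_word_closed)
  then show ?thesis
    unfolding steinberg_R_def by (rule normal_closure_normal)
qed

lemma group_St2: "group St2"
  unfolding St2_def by (rule normal.factorgroup_is_group[OF steinberg_R_normal])

lemma h_elt_in_St2: "\<alpha> \<in> {1, -1} \<Longrightarrow> h_elt \<alpha> c \<in> carrier St2"
  unfolding h_elt_def St2_def FactGroup_def RCOSETS_def
  using steinberg_word_closed(3) by auto

end

theory Submission
  imports Defs
begin

text \<open>Write \<open>St\<^sub>2 = F / R\<close>, let \<open>x = x\<^sub>\<alpha>\<close>, \<open>y = x\<^sub>-\<^sub>\<alpha>\<close>, \<open>w = w\<^sub>\<alpha>\<close>, \<open>h = h\<^sub>\<alpha>\<close>, and call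
  two elements of \<open>F\<close> \<open>n\<close>-close if their quotient is a product of \<open>n\<close> commutators
  \<open>[f, r]\<^sup>\<plusminus>\<^sup>1\<close> with \<open>r \<in> R\<close>.  Distances add up along chains and products, and are invariant under
  multiplication by any element.  It suffices to find lifts \<open>a\<close>, \<open>b\<close> of \<open>h(u)\<close>, \<open>h(v)\<close> such that
  \<open>[a, b]\<close> is close to \<open>1\<close>: this bounds the overcommutation length, and it implies that \<open>h(u)\<close> and
  \<open>h(v)\<close> overcommute, because for a central extension \<open>E\<close> of \<open>St\<^sub>2\<close> the projection \<open>F \<rightarrow> St\<^sub>2\<close> lifts
  to a homomorphism \<open>F \<rightarrow> E\<close>, which kills all \<open>[f, r]\<close>
  (\<open>overcommute_if_close\<close>, \<open>ocl_le_if_close\<close>).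

  In \<open>St\<^sub>2\<close> the elements \<open>h(u) = w(u) w(1)\<^sup>-\<^sup>1\<close> and \<open>h(v)\<close> commute because
  \<open>w(u) w(-1) w(v) = w(u v)\<close>, which is symmetric in \<open>u\<close> and \<open>v\<close>.  Indeed \<open>w(-1) = y(1) x(-1) y(1)\<close>,
  so the left-hand side is \<open>x(-u\<^sup>2) \<cdot> w(u) x(-1) w(v) \<cdot> x(-v\<^sup>2)\<close>; expanding \<open>w(u)\<close> and \<open>w(v)\<close>, the
  middle factor collapses to \<open>x(u) y(-1/u) y(-1/v) x(v)\<close> by \<open>u + v = 1\<close>, and
  \<open>u - u\<^sup>2 = u v = v - v\<^sup>2\<close>.

  Repeat this in \<open>F\<close> with palindromic lifts \<open>U\<close>, \<open>V\<close> of \<open>w(u)\<close>, \<open>w(v)\<close> and a lift \<open>M\<close> of \<open>w(-1)\<close>, and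
  compare \<open>U M V\<close> with \<open>V M U\<close>.  The difference only involves pairs of commuting elements: four pairs
  \<open>x(s), x(t)\<close> or \<open>y(s), y(t)\<close>, and the pairs \<open>w(u)\<^sup>2, y(1)\<close> and \<open>w(v)\<^sup>2, y(1)\<close>, the squares being
  central.  With one more commutator for the transposition of two lifts of \<open>x(u v)\<close>
  (\<open>close_palindromes\<close>), the total is \<open>4 \<cdot> 4 + 2 \<cdot> 2 + 1 = 21\<close>, by the following two estimates.

  For \<open>x(s), x(t)\<close> (\<open>close_commutator_doubling\<close>): conjugation by \<open>h(\<surd>2)\<close> doubles the arguments, so
  in a central extension the bimultiplicative map \<open>\<beta>(s, t) = [x(s), x(t)]\<close> satisfies
  \<open>4 \<beta>(s, t) = \<beta>(2 s, 2 t) = \<beta>(s, t)\<close>, whence \<open>\<beta>(s, 3 t / 2) = \<beta>(s, 2 t) - \<beta>(s, t / 2) = 0\<close>.  For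
  suitable lifts this takes four commutators.  For a central element \<open>z\<close> and \<open>y(1)\<close>
  (\<open>close_commutator_central\<close>): \<open>y(1) = [h(\<surd>2)\<^sup>-\<^sup>1, y(1)]\<close> is a commutator of elements whose lifts are
  fixed modulo \<open>R\<close> by conjugation with a lift of \<open>z\<close>, which costs one commutator for each of them.\<close>

section \<open>Counting commutators with relators\<close>

text \<open>The quotient \<open>x y\<^sup>-\<^sup>1\<close> is a product of exactly \<open>n\<close> commutators of elements of \<open>F\<close> with
  elements of \<open>R\<close>, or inverses of such.\<close>

definition FR_close ::
    "('a, 'm) monoid_scheme \<Rightarrow> 'a set \<Rightarrow> nat \<Rightarrow> 'a \<Rightarrow> 'a \<Rightarrow> bool" where
  "FR_close F R n x y \<longleftrightarrow> x \<in> carrier F \<and> y \<in> carrier F \<and>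
     (\<exists>cs. length cs = n \<and> set cs \<subseteq> FR_commutators F R \<and>
        x = foldr (mult F) cs \<one>\<^bsub>F\<^esub> \<otimes>\<^bsub>F\<^esub> y)"

context group
begin

lemma inv_mult_cancel: "\<lbrakk>x \<in> carrier G; y \<in> carrier G\<rbrakk> \<Longrightarrow> inv x \<otimes> (x \<otimes> y) = y"
  by (simp add: m_assoc[symmetric])

lemma mult_inv_cancel: "\<lbrakk>x \<in> carrier G; y \<in> carrier G\<rbrakk> \<Longrightarrow> x \<otimes> (inv x \<otimes> y) = y"
  by (simp add: m_assoc[symmetric])

text \<open>Together with the cancellation laws for \<open>inv x \<otimes> x\<close>, which are default simplification
  rules, these decide identities between words in elements of the carrier.\<close>

lemmas word_simps = m_assoc inv_mult_group inv_mult_cancel mult_inv_cancel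

lemma commutator_closed [simp]:
  "\<lbrakk>x \<in> carrier G; y \<in> carrier G\<rbrakk> \<Longrightarrow> commutator G x y \<in> carrier G"
  by (simp add: commutator_def)

lemma foldr_mult_closed [simp]:
  "set cs \<subseteq> carrier G \<Longrightarrow> foldr (\<otimes>) cs \<one> \<in> carrier G"
  by (induction cs) auto

lemma foldr_mult_append:
  "\<lbrakk>set cs \<subseteq> carrier G; set ds \<subseteq> carrier G\<rbrakk> \<Longrightarrow>
   foldr (\<otimes>) (cs @ ds) \<one> = foldr (\<otimes>) cs \<one> \<otimes> foldr (\<otimes>) ds \<one>"
  by (induction cs) (simp_all add: m_assoc)

lemma foldr_mult_conj:
  assumes "g \<in> carrier G"
  shows "set cs \<subseteq> carrier G \<Longrightarrow>
    foldr (\<otimes>) (map (\<lambda>c. g \<otimes> c \<otimes> inv g) cs) \<one> = g \<otimes> foldr (\<otimes>) cs \<one> \<otimes> inv g"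
  using assms by (induction cs) (simp_all add: word_simps)

lemma foldr_mult_inv:
  "set cs \<subseteq> carrier G \<Longrightarrow>
    foldr (\<otimes>) (rev (map (m_inv G) cs)) \<one> = inv (foldr (\<otimes>) cs \<one>)"
proof (induction cs)
  case (Cons c cs)
  then have "foldr (\<otimes>) (rev (map (m_inv G) cs) @ [inv c]) \<one> =
      foldr (\<otimes>) (rev (map (m_inv G) cs)) \<one> \<otimes> foldr (\<otimes>) [inv c] \<one>"
    by (intro foldr_mult_append) auto
  with Cons show ?case by (simp add: inv_mult_group)
qed simp

end

context normal
begin

lemma FR_commutators_closed: "FR_commutators G H \<subseteq> carrier G"
  using subset by (auto simp: FR_commutators_def)

lemma FR_commutators_inv: "c \<in> FR_commutators G H \<Longrightarrow> inv c \<in> FR_commutators G H"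
proof -
  assume "c \<in> FR_commutators G H"
  then obtain f r where fr: "f \<in> carrier G" "r \<in> H"
    and c: "c = commutator G f r \<or> c = inv (commutator G f r)"
    by (auto simp: FR_commutators_def)
  have "r \<in> carrier G" using fr subset by auto
  then have "inv c = inv (commutator G f r) \<or> inv c = commutator G f r"
    using c fr by auto
  then show ?thesis using fr unfolding FR_commutators_def by blast
qed

lemma FR_commutators_conj:
  assumes "c \<in> FR_commutators G H" "g \<in> carrier G"
  shows "g \<otimes> c \<otimes> inv g \<in> FR_commutators G H"
proof -
  obtain f r where fr: "f \<in> carrier G" "r \<in> H"
    and c: "c = commutator G f r \<or> c = inv (commutator G f r)"
    using assms by (auto simp: FR_commutators_def)
  have r: "r \<in> carrier G" using fr subset by auto
  have "g \<otimes> commutator G f r \<otimes> inv g = commutator G (g \<otimes> f \<otimes> inv g) (g \<otimes> r \<otimes> inv g)"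
    using fr r assms(2) by (simp add: commutator_def word_simps)
  moreover have "g \<otimes> inv (commutator G f r) \<otimes> inv g =
      inv (commutator G (g \<otimes> f \<otimes> inv g) (g \<otimes> r \<otimes> inv g))"
    using fr r assms(2) by (simp add: commutator_def word_simps)
  moreover have "g \<otimes> f \<otimes> inv g \<in> carrier G" "g \<otimes> r \<otimes> inv g \<in> H"
    using fr assms(2) inv_op_closed2 by auto
  ultimately show ?thesis
    using c unfolding FR_commutators_def by blast
qed

abbreviation close :: "nat \<Rightarrow> 'a \<Rightarrow> 'a \<Rightarrow> bool" where
  "close \<equiv> FR_close G H"

lemma closeI:
  assumes "x \<in> carrier G" "y \<in> carrier G" "set cs \<subseteq> FR_commutators G H" "length cs = n"
    "x = foldr (\<otimes>) cs \<one> \<otimes> y"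
  shows "close n x y"
  using assms unfolding FR_close_def by blast

lemma close_closed: "close n x y \<Longrightarrow> x \<in> carrier G" "close n x y \<Longrightarrow> y \<in> carrier G"
  by (auto simp: FR_close_def)

lemma close_refl: "x \<in> carrier G \<Longrightarrow> close 0 x x"
  by (rule closeI[of _ _ "[]"]) auto

lemma close_sym:
  assumes "close n x y"
  shows "close n y x"
proof -
  obtain cs where cs: "length cs = n" "set cs \<subseteq> FR_commutators G H"
    "x = foldr (\<otimes>) cs \<one> \<otimes> y" and xy: "x \<in> carrier G" "y \<in> carrier G"
    using assms by (auto simp: FR_close_def)
  have cl: "set cs \<subseteq> carrier G" using cs FR_commutators_closed by blast
  show ?thesis
  proof (rule closeI[of _ _ "rev (map (m_inv G) cs)"])
    show "y = foldr (\<otimes>) (rev (map (m_inv G) cs)) \<one> \<otimes> x"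
      unfolding foldr_mult_inv[OF cl] using cs xy cl by (simp add: inv_mult_cancel)
  qed (use cs xy FR_commutators_inv in auto)
qed

lemma close_trans:
  assumes "close n x y" "close m y z"
  shows "close (n + m) x z"
proof -
  obtain cs ds where cs: "length cs = n" "set cs \<subseteq> FR_commutators G H"
    "x = foldr (\<otimes>) cs \<one> \<otimes> y" and ds: "length ds = m" "set ds \<subseteq> FR_commutators G H"
    "y = foldr (\<otimes>) ds \<one> \<otimes> z" and xyz: "x \<in> carrier G" "z \<in> carrier G"
    using assms unfolding FR_close_def by blast
  have cl: "set cs \<subseteq> carrier G" "set ds \<subseteq> carrier G"
    using cs ds FR_commutators_closed by blast+
  show ?thesis
  proof (rule closeI[of _ _ "cs @ ds"])
    show "x = foldr (\<otimes>) (cs @ ds) \<one> \<otimes> z"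
      unfolding foldr_mult_append[OF cl] cs(3) ds(3) using cl xyz by (simp add: m_assoc)
  qed (use cs(1,2) ds(1,2) xyz in auto)
qed

lemma close_mult_right:
  assumes "close n x y" "g \<in> carrier G"
  shows "close n (x \<otimes> g) (y \<otimes> g)"
proof -
  obtain cs where cs: "length cs = n" "set cs \<subseteq> FR_commutators G H"
    "x = foldr (\<otimes>) cs \<one> \<otimes> y" and xy: "x \<in> carrier G" "y \<in> carrier G"
    using assms by (auto simp: FR_close_def)
  have cl: "set cs \<subseteq> carrier G" using cs FR_commutators_closed by blast
  show ?thesis
    by (rule closeI[of _ _ cs])
      (use cs(1,2) xy assms(2) cl in \<open>simp_all add: cs(3) m_assoc\<close>)
qed

lemma close_mult_left:
  assumes "close n x y" "g \<in> carrier G"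
  shows "close n (g \<otimes> x) (g \<otimes> y)"
proof -
  obtain cs where cs: "length cs = n" "set cs \<subseteq> FR_commutators G H"
    "x = foldr (\<otimes>) cs \<one> \<otimes> y" and xy: "x \<in> carrier G" "y \<in> carrier G"
    using assms by (auto simp: FR_close_def)
  have cl: "set cs \<subseteq> carrier G" using cs FR_commutators_closed by blast
  show ?thesis
  proof (rule closeI[of _ _ "map (\<lambda>c. g \<otimes> c \<otimes> inv g) cs"])
    show "g \<otimes> x = foldr (\<otimes>) (map (\<lambda>c. g \<otimes> c \<otimes> inv g) cs) \<one> \<otimes> (g \<otimes> y)"
      unfolding foldr_mult_conj[OF assms(2) cl] using cs(3) cl xy assms(2)
      by (simp add: word_simps)
  qed (use cs xy assms(2) FR_commutators_conj in auto)
qed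

lemma close_mult:
  assumes "close n x y" "close m x' y'"
  shows "close (n + m) (x \<otimes> x') (y \<otimes> y')"
  by (rule close_trans[OF close_mult_right close_mult_left])
    (use assms close_closed in auto)

lemma close_inv:
  assumes "close n x y"
  shows "close n (inv x) (inv y)"
proof -
  have cl: "x \<in> carrier G" "y \<in> carrier G" using assms by (auto simp: close_closed)
  have "close n (inv x \<otimes> y \<otimes> inv y) (inv x \<otimes> x \<otimes> inv y)"
    by (rule close_mult_right[OF close_mult_left[OF close_sym[OF assms]]]) (use cl in auto)
  with cl show ?thesis by (simp add: m_assoc)
qed

lemma close_conj:
  assumes "r \<in> H" "g \<in> carrier G"
  shows "close 1 (g \<otimes> r \<otimes> inv g) r"
proof (rule closeI[of _ _ "[commutator G g r]"])
  have r: "r \<in> carrier G" using assms subset by auto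
  then show "g \<otimes> r \<otimes> inv g \<in> carrier G" "r \<in> carrier G"
    "g \<otimes> r \<otimes> inv g = foldr (\<otimes>) [commutator G g r] \<one> \<otimes> r"
    using assms by (auto simp: commutator_def word_simps)
qed (use assms in \<open>auto simp: FR_commutators_def\<close>)

lemma close_conj_conj:
  assumes "r \<in> H" "g \<in> carrier G" "k \<in> carrier G"
  shows "close 1 (g \<otimes> r \<otimes> inv g) (k \<otimes> r \<otimes> inv k)"
proof -
  have r: "r \<in> carrier G" using assms subset by auto
  have "close 1 ((g \<otimes> inv k) \<otimes> (k \<otimes> r \<otimes> inv k) \<otimes> inv (g \<otimes> inv k)) (k \<otimes> r \<otimes> inv k)"
    using assms by (intro close_conj) (auto simp: inv_op_closed2)
  then show ?thesis using assms r by (simp add: word_simps)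
qed

lemma close_commute:
  assumes "close n (commutator G x y) \<one>" "x \<in> carrier G" "y \<in> carrier G"
  shows "close n (x \<otimes> y) (y \<otimes> x)"
  using close_mult_right[OF assms(1), of "y \<otimes> x"] assms
  by (simp add: commutator_def word_simps)

lemma close_commute_sym:
  assumes "close n (commutator G x y) \<one>" "x \<in> carrier G" "y \<in> carrier G"
  shows "close n (y \<otimes> x) (x \<otimes> y)"
  using close_commute[OF assms] by (rule close_sym)

lemma close_commutator_left:
  assumes "r \<in> H" "f \<in> carrier G" "g \<in> carrier G"
  shows "close 1 (commutator G (f \<otimes> r) g) (commutator G f g)"
proof -
  have r: "r \<in> carrier G" using assms subset by auto
  have "close 1 (f \<otimes> r \<otimes> (g \<otimes> inv r \<otimes> inv g) \<otimes> (g \<otimes> inv f \<otimes> inv g))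
                (f \<otimes> r \<otimes> inv r \<otimes> (g \<otimes> inv f \<otimes> inv g))"
    using assms r by (intro close_mult_right close_mult_left close_conj) auto
  then show ?thesis using assms r by (simp add: commutator_def word_simps)
qed

lemma inv_commutator:
  "\<lbrakk>x \<in> carrier G; y \<in> carrier G\<rbrakk> \<Longrightarrow> inv (commutator G x y) = commutator G y x"
  by (simp add: commutator_def word_simps)

lemma close_commutator_right:
  assumes "r \<in> H" "f \<in> carrier G" "g \<in> carrier G"
  shows "close 1 (commutator G g (f \<otimes> r)) (commutator G g f)"
proof -
  have r: "r \<in> carrier G" using assms subset by auto
  show ?thesis
    using close_inv[OF close_commutator_left[OF assms]] assms r by (simp add: inv_commutator)
qed

end


context group_hom
begin

lemma kernelI: "\<lbrakk>x \<in> carrier G; h x = \<one>\<^bsub>H\<^esub>\<rbrakk> \<Longrightarrow> x \<in> kernel G H h"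
  by (simp add: kernel_def)

interpretation K: normal "kernel G H h" G
  by (rule normal_kernel)

lemma commutator_in_kernel:
  assumes "x \<in> carrier G" "y \<in> carrier G" "h x \<otimes>\<^bsub>H\<^esub> h y = h y \<otimes>\<^bsub>H\<^esub> h x"
  shows "commutator G x y \<in> kernel G H h"
proof -
  have "h (commutator G x y) = h y \<otimes>\<^bsub>H\<^esub> h x \<otimes>\<^bsub>H\<^esub> inv\<^bsub>H\<^esub> h x \<otimes>\<^bsub>H\<^esub> inv\<^bsub>H\<^esub> h y"
    using assms by (simp add: commutator_def)
  also have "\<dots> = \<one>\<^bsub>H\<^esub>" using assms(1,2) by (simp add: H.m_assoc)
  finally show ?thesis using assms(1,2) by (intro kernelI) simp_all
qed

lemma eq_mult_kernel:
  assumes "x \<in> carrier G" "y \<in> carrier G" "h x = h y"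
  obtains r where "r \<in> kernel G H h" "x = y \<otimes> r"
proof
  show "inv y \<otimes> x \<in> kernel G H h" using assms by (intro kernelI) simp_all
  show "x = y \<otimes> (inv y \<otimes> x)" using assms by (simp add: G.word_simps)
qed

text \<open>The element \<open>k\<close> stands for a lift of \<open>h(\<surd>2)\<close>, whose conjugation squares the images of \<open>a\<close> and
  \<open>b\<close>.  Modulo central elements \<open>[a, B\<^sup>2] = [a\<^sup>2, B] = [k a k\<^sup>-\<^sup>1, k b k\<^sup>-\<^sup>1] = [a, b]\<close>, so
  \<open>[a, B\<^sup>2 b\<^sup>-\<^sup>1]\<close> vanishes.\<close>

lemma close_commutator_doubling:
  assumes a: "a \<in> carrier G" and b: "b \<in> carrier G" and k: "k \<in> carrier G"
    and B: "B = k \<otimes> b \<otimes> inv k"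
    and ha: "h (k \<otimes> a \<otimes> inv k) = h (a \<otimes> a)" and hb: "h B = h (b \<otimes> b)"
    and comm: "h a \<otimes>\<^bsub>H\<^esub> h b = h b \<otimes>\<^bsub>H\<^esub> h a"
  shows "FR_close G (kernel G H h) 4 (commutator G a (B \<otimes> B \<otimes> inv b)) \<one>"
proof -
  define \<rho> \<sigma> where "\<rho> = commutator G a b" and "\<sigma> = commutator G a B"
  have Bc: "B \<in> carrier G" using B b k by simp
  have \<rho>: "\<rho> \<in> kernel G H h" unfolding \<rho>_def using a b comm by (rule commutator_in_kernel)
  have "h a \<otimes>\<^bsub>H\<^esub> (h b \<otimes>\<^bsub>H\<^esub> h b) = h b \<otimes>\<^bsub>H\<^esub> h b \<otimes>\<^bsub>H\<^esub> h a"
    using a b comm by (metis H.m_assoc hom_closed)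
  then have \<sigma>: "\<sigma> \<in> kernel G H h"
    unfolding \<sigma>_def using a b Bc hb by (intro commutator_in_kernel) simp_all
  have cl: "\<rho> \<in> carrier G" "\<sigma> \<in> carrier G" using \<rho> \<sigma> by auto
  obtain s where s: "s \<in> kernel G H h" "k \<otimes> a \<otimes> inv k = a \<otimes> a \<otimes> s"
    by (rule eq_mult_kernel[OF _ _ ha]) (use a k in auto)
  have "K.close 1 (commutator G (a \<otimes> a \<otimes> s) B) (commutator G (a \<otimes> a) B)"
    by (rule K.close_commutator_left) (use s a Bc in auto)
  moreover have "commutator G (a \<otimes> a \<otimes> s) B = k \<otimes> \<rho> \<otimes> inv k"
    unfolding s(2)[symmetric] B \<rho>_def using a b k by (simp add: commutator_def G.word_simps)
  moreover have "commutator G (a \<otimes> a) B = a \<otimes> \<sigma> \<otimes> inv a \<otimes> \<sigma>"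
    unfolding \<sigma>_def using a Bc by (simp add: commutator_def G.word_simps)
  moreover have "K.close 1 (a \<otimes> \<sigma> \<otimes> inv a \<otimes> \<sigma>) (\<sigma> \<otimes> \<sigma>)"
    by (intro K.close_mult_right K.close_conj) (use a cl \<sigma> in auto)
  ultimately have "K.close (1 + 1) (k \<otimes> \<rho> \<otimes> inv k) (\<sigma> \<otimes> \<sigma>)"
    using K.close_trans[of 1 "k \<otimes> \<rho> \<otimes> inv k" "a \<otimes> \<sigma> \<otimes> inv a \<otimes> \<sigma>" 1 "\<sigma> \<otimes> \<sigma>"] by simp
  then have "K.close 2 (inv (k \<otimes> \<rho> \<otimes> inv k)) (inv (\<sigma> \<otimes> \<sigma>))"
    unfolding one_add_one by (rule K.close_inv)
  then have 1: "K.close 2 (\<sigma> \<otimes> \<sigma> \<otimes> (k \<otimes> inv \<rho> \<otimes> inv k)) \<one>"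
    using K.close_mult_left[of 2 "inv (k \<otimes> \<rho> \<otimes> inv k)" "inv (\<sigma> \<otimes> \<sigma>)" "\<sigma> \<otimes> \<sigma>"] cl k
    by (simp add: G.word_simps)
  have "K.close (0 + 1 + 1)
      (\<sigma> \<otimes> (B \<otimes> \<sigma> \<otimes> inv B) \<otimes> ((B \<otimes> B \<otimes> inv b) \<otimes> inv \<rho> \<otimes> inv (B \<otimes> B \<otimes> inv b)))
      (\<sigma> \<otimes> \<sigma> \<otimes> (k \<otimes> inv \<rho> \<otimes> inv k))"
    by (intro K.close_mult K.close_refl K.close_conj K.close_conj_conj)
      (use cl \<rho> \<sigma> Bc b k in auto)
  moreover have "commutator G a (B \<otimes> B \<otimes> inv b) =
      \<sigma> \<otimes> (B \<otimes> \<sigma> \<otimes> inv B) \<otimes> ((B \<otimes> B \<otimes> inv b) \<otimes> inv \<rho> \<otimes> inv (B \<otimes> B \<otimes> inv b))"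
    unfolding \<sigma>_def \<rho>_def using a b Bc by (simp add: commutator_def G.word_simps)
  ultimately have "K.close (0 + 1 + 1 + 2) (commutator G a (B \<otimes> B \<otimes> inv b)) \<one>"
    using K.close_trans[OF _ 1] by metis
  then show ?thesis by (simp add: eval_nat_numeral)
qed

text \<open>Conjugation by \<open>z\<close> changes \<open>k\<close> and \<open>y\<close> by elements of the kernel only, and each of the two
  changes alters \<open>[k, y]\<close> by one commutator.\<close>

lemma close_commutator_central:
  assumes z: "z \<in> carrier G" and k: "k \<in> carrier G" and y: "y \<in> carrier G"
    and zk: "h z \<otimes>\<^bsub>H\<^esub> h k = h k \<otimes>\<^bsub>H\<^esub> h z" and zy: "h z \<otimes>\<^bsub>H\<^esub> h y = h y \<otimes>\<^bsub>H\<^esub> h z"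
  shows "FR_close G (kernel G H h) 2 (commutator G z (commutator G k y)) \<one>"
proof -
  have *: "h (z \<otimes> x \<otimes> inv z) = h x"
    if "x \<in> carrier G" "h z \<otimes>\<^bsub>H\<^esub> h x = h x \<otimes>\<^bsub>H\<^esub> h z" for x
    using that z by (simp add: H.m_assoc)
  obtain r where r: "r \<in> kernel G H h" "z \<otimes> k \<otimes> inv z = k \<otimes> r"
    by (rule eq_mult_kernel[OF _ _ *[OF k zk]]) (use z k in auto)
  obtain s where s: "s \<in> kernel G H h" "z \<otimes> y \<otimes> inv z = y \<otimes> s"
    by (rule eq_mult_kernel[OF _ _ *[OF y zy]]) (use z y in auto)
  have cl: "s \<in> carrier G" using s by auto
  have "K.close (1 + 1) (commutator G (k \<otimes> r) (y \<otimes> s)) (commutator G k y)"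
    using r s k y cl
    by (intro K.close_trans[OF K.close_commutator_left K.close_commutator_right]) auto
  moreover have "commutator G z (commutator G k y) =
      commutator G (k \<otimes> r) (y \<otimes> s) \<otimes> inv (commutator G k y)"
    unfolding r(2)[symmetric] s(2)[symmetric]
    using z k y by (simp add: commutator_def G.word_simps)
  ultimately show ?thesis
    using K.close_mult_right[of 2 "commutator G (k \<otimes> r) (y \<otimes> s)" "commutator G k y" "inv (commutator G k y)"]
      k y by (simp add: numeral_2_eq_2)
qed

text \<open>The letters \<open>a\<close>, \<open>b\<close>, \<open>c\<close>, \<open>d\<close>, \<open>y\<close> stand for lifts of \<open>x(u)\<close>, \<open>x(v)\<close>, \<open>y(-1/u)\<close>, \<open>y(-1/v)\<close>,
  \<open>y(1)\<close>.  Then \<open>U\<close>, \<open>V\<close>, \<open>M\<close> lift \<open>w(u)\<close>, \<open>w(v)\<close>, \<open>w(-1)\<close>; \<open>P\<close> and \<open>Q\<close> lift \<open>x(-u\<^sup>2)\<close> and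
  \<open>x(-v\<^sup>2)\<close>; and \<open>P a\<close>, \<open>Q b\<close> are two lifts of \<open>x(u v)\<close>.  With \<open>N = d c\<close>, the words \<open>U M V\<close> and
  \<open>V M U\<close> are 10-close to \<open>(P a) N (Q b)\<close> and \<open>(Q b) N (P a)\<close>, which are 1-close.\<close>

lemma close_palindromes:
  assumes cl: "a \<in> carrier G" "b \<in> carrier G" "c \<in> carrier G" "d \<in> carrier G" "y \<in> carrier G"
    and U: "U = a \<otimes> c \<otimes> a" and V: "V = b \<otimes> d \<otimes> b"
    and M: "M = y \<otimes> inv a \<otimes> inv b \<otimes> y"
    and P: "P = U \<otimes> y \<otimes> inv U" and Q: "Q = V \<otimes> y \<otimes> inv V"
    and hPQ: "h (P \<otimes> a) = h (Q \<otimes> b)"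
    and Uy: "FR_close G (kernel G H h) 2 (commutator G (U \<otimes> U) y) \<one>"
    and Vy: "FR_close G (kernel G H h) 2 (commutator G (V \<otimes> V) y) \<one>"
    and ab: "FR_close G (kernel G H h) 4 (commutator G a b) \<one>"
    and cd: "FR_close G (kernel G H h) 4 (commutator G c d) \<one>"
    and Pa: "FR_close G (kernel G H h) 4 (commutator G P a) \<one>"
    and Qb: "FR_close G (kernel G H h) 4 (commutator G Q b) \<one>"
  shows "FR_close G (kernel G H h) 21 (commutator G (U \<otimes> M) (V \<otimes> M)) \<one>"
proof -
  have UV: "U \<in> carrier G" "V \<in> carrier G" using cl U V by simp_all
  have M': "M \<in> carrier G" and PQ: "P \<in> carrier G" "Q \<in> carrier G"
    using cl UV M P Q by simp_all
  \<comment> \<open>Centrality of \<open>X\<^sup>2\<close> modulo the kernel makes the two conjugates of \<open>y\<close> by \<open>X\<close> agree there.\<close>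
  have swap: "K.close 2 (inv X \<otimes> y \<otimes> X) (X \<otimes> y \<otimes> inv X)"
    if "K.close 2 (commutator G (X \<otimes> X) y) \<one>" "X \<in> carrier G" for X
  proof -
    have "K.close 2 (inv X \<otimes> (y \<otimes> (X \<otimes> X)) \<otimes> inv X) (inv X \<otimes> ((X \<otimes> X) \<otimes> y) \<otimes> inv X)"
      by (intro K.close_mult_right K.close_mult_left K.close_commute_sym that(1))
        (use that(2) cl in auto)
    then show ?thesis using that(2) cl by (simp add: G.word_simps)
  qed
  define N where "N = d \<otimes> c"
  have N: "N \<in> carrier G" using cl N_def by simp
  have "K.close (0 + 4 + (2 + 4))
      ((P \<otimes> a) \<otimes> (c \<otimes> d) \<otimes> (b \<otimes> (inv V \<otimes> y \<otimes> V))) ((P \<otimes> a) \<otimes> N \<otimes> (Q \<otimes> b))"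
    unfolding N_def using cl PQ UV swap[OF Vy]
    by (intro K.close_mult K.close_refl K.close_commute[OF cd]
        K.close_trans[OF K.close_mult_left K.close_commute_sym[OF Qb]])
      (auto simp: Q)
  moreover have "U \<otimes> M \<otimes> V = (P \<otimes> a) \<otimes> (c \<otimes> d) \<otimes> (b \<otimes> (inv V \<otimes> y \<otimes> V))"
    unfolding P M U V using cl by (simp add: G.word_simps)
  ultimately have UMV: "K.close 10 (U \<otimes> M \<otimes> V) ((P \<otimes> a) \<otimes> N \<otimes> (Q \<otimes> b))" by simp
  have ba: "K.close 4 (b \<otimes> inv a \<otimes> inv b \<otimes> a) \<one>"
  proof -
    have "K.close 4 (inv a \<otimes> (a \<otimes> b) \<otimes> (inv a \<otimes> inv b \<otimes> a)) (inv a \<otimes> (b \<otimes> a) \<otimes> (inv a \<otimes> inv b \<otimes> a))"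
      by (intro K.close_mult_right K.close_mult_left K.close_commute ab) (use cl in auto)
    then show ?thesis using cl by (simp add: G.word_simps)
  qed
  have "K.close (0 + 4 + 0 + (2 + 4))
      ((Q \<otimes> b \<otimes> d) \<otimes> (b \<otimes> inv a \<otimes> inv b \<otimes> a) \<otimes> c \<otimes> (a \<otimes> (inv U \<otimes> y \<otimes> U)))
      ((Q \<otimes> b \<otimes> d) \<otimes> \<one> \<otimes> c \<otimes> (P \<otimes> a))"
    using cl PQ UV swap[OF Uy]
    by (intro K.close_mult K.close_refl ba
        K.close_trans[OF K.close_mult_left K.close_commute_sym[OF Pa]])
      (auto simp: P)
  moreover have "V \<otimes> M \<otimes> U =
      (Q \<otimes> b \<otimes> d) \<otimes> (b \<otimes> inv a \<otimes> inv b \<otimes> a) \<otimes> c \<otimes> (a \<otimes> (inv U \<otimes> y \<otimes> U))"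
    unfolding Q M U V using cl by (simp add: G.word_simps)
  moreover have "(Q \<otimes> b \<otimes> d) \<otimes> \<one> \<otimes> c \<otimes> (P \<otimes> a) = (Q \<otimes> b) \<otimes> N \<otimes> (P \<otimes> a)"
    unfolding N_def using cl PQ by (simp add: G.m_assoc)
  ultimately have VMU: "K.close 10 (V \<otimes> M \<otimes> U) ((Q \<otimes> b) \<otimes> N \<otimes> (P \<otimes> a))" by simp
  obtain r where r: "r \<in> kernel G H h" "P \<otimes> a = (Q \<otimes> b) \<otimes> r"
    by (rule eq_mult_kernel[OF _ _ hPQ]) (use cl PQ in auto)
  have rc: "r \<in> carrier G" using r by auto
  define B where "B = Q \<otimes> b"
  have B: "B \<in> carrier G" using cl PQ B_def by simp
  have "K.close 1 (B \<otimes> r \<otimes> (N \<otimes> B)) (B \<otimes> ((N \<otimes> B) \<otimes> r \<otimes> inv (N \<otimes> B)) \<otimes> (N \<otimes> B))"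
    by (intro K.close_mult_right K.close_mult_left K.close_sym[OF K.close_conj]) (use B r N in auto)
  then have "K.close 1 ((P \<otimes> a) \<otimes> N \<otimes> (Q \<otimes> b)) ((Q \<otimes> b) \<otimes> N \<otimes> (P \<otimes> a))"
    unfolding r(2) B_def[symmetric] using B rc N by (simp add: G.word_simps)
  then have "K.close (10 + (1 + 10)) (U \<otimes> M \<otimes> V) (V \<otimes> M \<otimes> U)"
    by (intro K.close_trans[OF UMV K.close_trans[OF _ K.close_sym[OF VMU]]])
  then have "K.close 21 (U \<otimes> M \<otimes> V \<otimes> inv (V \<otimes> M \<otimes> U)) (V \<otimes> M \<otimes> U \<otimes> inv (V \<otimes> M \<otimes> U))"
    by (intro K.close_mult_right) (use UV M' in auto)
  then show ?thesis using UV M' by (simp add: commutator_def G.word_simps)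
qed


text \<open>Every element \<open>f s\<close> of a root subgroup has a lift of the special form \<open>B\<^sup>2 b\<^sup>-\<^sup>1\<close>, where \<open>b\<close> lifts
  \<open>f (s / 3)\<close>; the other element of the commuting pair may be lifted arbitrarily.\<close>

lemma ex_lift_close_commute:
  fixes f :: "'k::field \<Rightarrow> 'c"
  assumes k: "k \<in> carrier G" and f: "\<And>t. f t \<in> carrier H"
    and f_add: "\<And>s t. f (s + t) = f s \<otimes>\<^bsub>H\<^esub> f t"
    and kf: "\<And>t. h k \<otimes>\<^bsub>H\<^esub> f t = f (2 * t) \<otimes>\<^bsub>H\<^esub> h k"
    and b: "b \<in> carrier G" "h b = f (s / 3)" and three: "(3::'k) \<noteq> 0"
  shows "\<exists>c\<in>carrier G. h c = f s \<and>
    (\<forall>a\<in>carrier G. \<forall>t. h a = f t \<longrightarrow> FR_close G (kernel G H h) 4 (commutator G a c) \<one>)"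
proof -
  have conj: "h (k \<otimes> a \<otimes> inv k) = f (2 * t)" if "a \<in> carrier G" "h a = f t" for a t
    using that k f by (simp add: kf H.m_assoc)
  define B where "B = k \<otimes> b \<otimes> inv k"
  have B: "B \<in> carrier G" "h B = f (2 * (s / 3))"
    unfolding B_def using conj[OF b] b k by simp_all
  have "h (B \<otimes> B) = f (2 * (s / 3) + 2 * (s / 3))"
    using B by (simp only: f_add hom_mult)
  also have "2 * (s / 3) + 2 * (s / 3) = 3 * (s / 3) + 1 * (s / 3)"
    unfolding distrib_right[symmetric] by simp
  also have "\<dots> = s + s / 3" using three by simp
  finally have "h (B \<otimes> B \<otimes> inv b) = f s"
    using B b f by (simp add: f_add H.m_assoc)
  moreover have "FR_close G (kernel G H h) 4 (commutator G a (B \<otimes> B \<otimes> inv b)) \<one>"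
    if a: "a \<in> carrier G" "h a = f t" for a t
  proof (rule close_commutator_doubling[OF a(1) b(1) k B_def])
    show "h (k \<otimes> a \<otimes> inv k) = h (a \<otimes> a)"
      using a by (simp only: conj[OF a] mult_2 f_add hom_mult)
    show "h B = h (b \<otimes> b)"
      using b by (simp only: B(2) mult_2 f_add hom_mult)
    show "h a \<otimes>\<^bsub>H\<^esub> h b = h b \<otimes>\<^bsub>H\<^esub> h a"
      unfolding a b f_add[symmetric] by (simp add: add.commute)
  qed
  ultimately show ?thesis using B b by (intro bexI[of _ "B \<otimes> B \<otimes> inv b"]) auto
qed

end


section \<open>Relations in the Steinberg group\<close>

text \<open>A group with elements \<open>x t\<close>, \<open>y t\<close> that satisfy the Steinberg relations for one of the two roots:
  \<open>x = x\<^sub>\<alpha>\<close> and \<open>y = x\<^sub>-\<^sub>\<alpha>\<close>.  The conjugation relation for the other root is not required, since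
  \<open>w(c)\<^sup>-\<^sup>1 = w(-c)\<close> yields the action of \<open>w(c)\<close> on \<open>y\<close>.\<close>

locale steinberg_pair = group G for G (structure) +
  fixes x y :: "'k::field \<Rightarrow> 'a"
  assumes x_closed [simp]: "x t \<in> carrier G" and y_closed [simp]: "y t \<in> carrier G"
    and x_add: "x (s + t) = x s \<otimes> x t" and y_add: "y (s + t) = y s \<otimes> y t"
    and weyl: "c \<noteq> 0 \<Longrightarrow> (x c \<otimes> y (- inverse c) \<otimes> x c) \<otimes> x t =
      y (- (t / c\<^sup>2)) \<otimes> (x c \<otimes> y (- inverse c) \<otimes> x c)"
begin

text \<open>The element \<open>w\<^sub>\<alpha>(c)\<close>.\<close>

definition w :: "'k \<Rightarrow> 'a" where
  "w c = x c \<otimes> y (- inverse c) \<otimes> x c"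

text \<open>The element \<open>h\<^sub>\<alpha>(c)\<close> of the torus.\<close>

definition tor :: "'k \<Rightarrow> 'a" where
  "tor c = w c \<otimes> inv (w 1)"

lemma w_closed [simp]: "w c \<in> carrier G"
  by (simp add: w_def)

lemma tor_closed [simp]: "tor c \<in> carrier G"
  by (simp add: tor_def)

lemma x_zero: "x 0 = \<one>" and y_zero: "y 0 = \<one>"
  using x_add[of 0 0] y_add[of 0 0] by simp_all

lemma inv_x: "inv (x t) = x (- t)"
  by (rule inv_equality) (simp_all add: x_add[symmetric] x_zero)

lemma inv_y: "inv (y t) = y (- t)"
  by (rule inv_equality) (simp_all add: y_add[symmetric] y_zero)

lemma inv_w: "inv (w c) = w (- c)"
  by (simp add: w_def inv_mult_group inv_x inv_y m_assoc)

lemma w_x: "c \<noteq> 0 \<Longrightarrow> w c \<otimes> x t = y (- (t / c\<^sup>2)) \<otimes> w c"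
  unfolding w_def by (rule weyl)

lemma intertwine_inv:
  assumes "g \<otimes> a = b \<otimes> g" "g \<in> carrier G" "a \<in> carrier G" "b \<in> carrier G"
  shows "inv g \<otimes> b = a \<otimes> inv g"
proof -
  have "inv g \<otimes> (g \<otimes> a) \<otimes> inv g = inv g \<otimes> (b \<otimes> g) \<otimes> inv g" using assms(1) by simp
  then show ?thesis using assms(2-) by (simp add: word_simps)
qed

lemma intertwine_mult:
  assumes "g \<otimes> a = b \<otimes> g" "k \<otimes> b = c \<otimes> k" "g \<in> carrier G" "k \<in> carrier G"
    "a \<in> carrier G" "b \<in> carrier G" "c \<in> carrier G"
  shows "(k \<otimes> g) \<otimes> a = c \<otimes> (k \<otimes> g)"
proof -
  have "(k \<otimes> g) \<otimes> a = (k \<otimes> b) \<otimes> g" using assms(1,3-) by (simp add: m_assoc)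
  then show ?thesis using assms(2-) by (simp add: m_assoc)
qed

lemma w_y: "c \<noteq> 0 \<Longrightarrow> w c \<otimes> y t = x (- (c\<^sup>2 * t)) \<otimes> w c"
  using intertwine_inv[OF w_x[of "- c" "- (c\<^sup>2 * t)"]] by (simp add: inv_w)

text \<open>Conjugation by \<open>w c\<close> fixes \<open>w c\<close> and interchanges \<open>x c\<close> and \<open>y (- inverse c)\<close>.\<close>

lemma w_braid:
  assumes "c \<noteq> 0"
  shows "w c = y (- inverse c) \<otimes> x c \<otimes> y (- inverse c)"
proof -
  have 1: "w c \<otimes> x c = y (- inverse c) \<otimes> w c"
    using w_x[OF assms, of c] assms by (simp add: power2_eq_square inverse_eq_divide)
  have 2: "w c \<otimes> y (- inverse c) = x c \<otimes> w c"
    using w_y[OF assms, of "- inverse c"] assms by (simp add: power2_eq_square mult.assoc)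
  have "w c \<otimes> w c = w c \<otimes> x c \<otimes> y (- inverse c) \<otimes> x c"
    by (simp add: w_def m_assoc)
  also have "\<dots> = y (- inverse c) \<otimes> (w c \<otimes> y (- inverse c)) \<otimes> x c"
    by (simp add: 1 m_assoc)
  also have "\<dots> = y (- inverse c) \<otimes> x c \<otimes> (w c \<otimes> x c)"
    by (simp add: 2 m_assoc)
  also have "\<dots> = (y (- inverse c) \<otimes> x c \<otimes> y (- inverse c)) \<otimes> w c"
    by (simp add: 1 m_assoc)
  finally show ?thesis by simp
qed

lemma tor_x: "c \<noteq> 0 \<Longrightarrow> tor c \<otimes> x t = x (c\<^sup>2 * t) \<otimes> tor c"
  using w_x[of "- 1" t] w_y[of c "- t"] intertwine_mult[of "w (- 1)" "x t" "y (- t)" "w c"]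
  by (simp add: tor_def inv_w)

lemma tor_y: "c \<noteq> 0 \<Longrightarrow> tor c \<otimes> y t = y (t / c\<^sup>2) \<otimes> tor c"
  using w_y[of "- 1" t] w_x[of c "- t"] intertwine_mult[of "w (- 1)" "y t" "x (- t)" "w c"]
  by (simp add: tor_def inv_w)

lemma w_square_commutes_x: "c \<noteq> 0 \<Longrightarrow> (w c \<otimes> w c) \<otimes> x t = x t \<otimes> (w c \<otimes> w c)"
  using intertwine_mult[OF w_x[of c t] w_y[of c "- (t / c\<^sup>2)"]] by simp

lemma w_square_commutes_y: "c \<noteq> 0 \<Longrightarrow> (w c \<otimes> w c) \<otimes> y t = y t \<otimes> (w c \<otimes> w c)"
  using intertwine_mult[OF w_y[of c t] w_x[of c "- (c\<^sup>2 * t)"]] by simp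

lemma commute_mult:
  assumes "z \<otimes> a = a \<otimes> z" "z \<otimes> b = b \<otimes> z" "z \<in> carrier G" "a \<in> carrier G" "b \<in> carrier G"
  shows "z \<otimes> (a \<otimes> b) = (a \<otimes> b) \<otimes> z"
  using intertwine_mult[of b z z a z] assms by simp

lemma w_square_commutes_w:
  assumes "c \<noteq> 0"
  shows "(w c \<otimes> w c) \<otimes> w d = w d \<otimes> (w c \<otimes> w c)"
  unfolding w_def[of d]
  by (intro commute_mult w_square_commutes_x w_square_commutes_y assms m_closed
      x_closed y_closed w_closed)

lemma w_square_commutes_tor:
  assumes "c \<noteq> 0"
  shows "(w c \<otimes> w c) \<otimes> inv (tor d) = inv (tor d) \<otimes> (w c \<otimes> w c)"
proof -
  have "(w c \<otimes> w c) \<otimes> tor d = tor d \<otimes> (w c \<otimes> w c)"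
    unfolding tor_def inv_w
    by (intro commute_mult w_square_commutes_w assms m_closed w_closed)
  then show ?thesis using intertwine_inv[of "tor d" "w c \<otimes> w c" "w c \<otimes> w c"] by simp
qed

end

lemma (in group_hom) ex_close_torus_lifts:
  fixes x y :: "'k::field \<Rightarrow> 'c" and c u v :: 'k
  assumes "steinberg_pair H x y" and surj: "carrier H \<subseteq> h ` carrier G"
    and c: "c\<^sup>2 = 2" "c \<noteq> 0" and three: "(3::'k) \<noteq> 0"
    and uv: "u \<noteq> 0" "v \<noteq> 0" "u + v = 1"
  shows "\<exists>a\<in>carrier G. \<exists>b\<in>carrier G. h a = steinberg_pair.tor H x y u \<and>
    h b = steinberg_pair.tor H x y v \<and> FR_close G (kernel G H h) 21 (commutator G a b) \<one>"
proof -
  interpret S: steinberg_pair H x y by fact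
  have lift: "\<exists>f\<in>carrier G. h f = g" if "g \<in> carrier H" for g
    using surj that by blast
  have two: "(2::'k) \<noteq> 0" using c by auto
  obtain k where k: "k \<in> carrier G" "h k = S.tor c" using lift[of "S.tor c"] by auto
  have kx: "h k \<otimes>\<^bsub>H\<^esub> x t = x (2 * t) \<otimes>\<^bsub>H\<^esub> h k" for t
    using S.tor_x[OF c(2), of t] by (simp add: k c)
  have ky: "h (inv k) \<otimes>\<^bsub>H\<^esub> y t = y (2 * t) \<otimes>\<^bsub>H\<^esub> h (inv k)" for t
    using S.intertwine_inv[OF S.tor_y[OF c(2), of "2 * t"]] k two by (simp add: c)
  obtain a0 where a0: "a0 \<in> carrier G" "h a0 = x (u / 3)" using lift[OF S.x_closed] by blast
  obtain b0 where b0: "b0 \<in> carrier G" "h b0 = x (v / 3)" using lift[OF S.x_closed] by blast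
  obtain d0 where d0: "d0 \<in> carrier G" "h d0 = y (- inverse v / 3)"
    using lift[OF S.y_closed] by blast
  obtain e where e: "e \<in> carrier G" "h e = y (- inverse u)" using lift[OF S.y_closed] by blast
  obtain q where q: "q \<in> carrier G" "h q = y 1" using lift[OF S.y_closed] by blast
  obtain a where a: "a \<in> carrier G" "h a = x u"
    and a_comm: "\<And>p t. \<lbrakk>p \<in> carrier G; h p = x t\<rbrakk> \<Longrightarrow>
      FR_close G (kernel G H h) 4 (commutator G p a) \<one>"
    using ex_lift_close_commute[OF k(1) S.x_closed S.x_add kx a0 three] by blast
  obtain b where b: "b \<in> carrier G" "h b = x v"
    and b_comm: "\<And>p t. \<lbrakk>p \<in> carrier G; h p = x t\<rbrakk> \<Longrightarrow>
      FR_close G (kernel G H h) 4 (commutator G p b) \<one>"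
    using ex_lift_close_commute[OF k(1) S.x_closed S.x_add kx b0 three] by blast
  obtain d where d: "d \<in> carrier G" "h d = y (- inverse v)"
    and d_comm: "\<And>p t. \<lbrakk>p \<in> carrier G; h p = y t\<rbrakk> \<Longrightarrow>
      FR_close G (kernel G H h) 4 (commutator G p d) \<one>"
    using ex_lift_close_commute[OF G.inv_closed[OF k(1)] S.y_closed S.y_add ky d0 three] by blast
  \<comment> \<open>A lift of \<open>y 1\<close> that is a commutator, as needed for \<open>close_commutator_central\<close>.\<close>
  define m where "m = commutator G (inv k) q"
  have m: "m \<in> carrier G" using k q by (simp add: m_def)
  have "h m = h (inv k) \<otimes>\<^bsub>H\<^esub> y 1 \<otimes>\<^bsub>H\<^esub> h k \<otimes>\<^bsub>H\<^esub> y (- 1)"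
    using k q by (simp add: m_def commutator_def S.inv_y)
  also have "\<dots> = y (2 * 1) \<otimes>\<^bsub>H\<^esub> y (- 1)"
    unfolding ky using k by (simp add: H.m_assoc)
  also have "\<dots> = y 1" by (simp add: S.y_add[symmetric])
  finally have hm: "h m = y 1" .
  define U V M where "U = a \<otimes> e \<otimes> a" and "V = b \<otimes> d \<otimes> b" and "M = m \<otimes> inv a \<otimes> inv b \<otimes> m"
  define P Q where "P = U \<otimes> m \<otimes> inv U" and "Q = V \<otimes> m \<otimes> inv V"
  have cl: "U \<in> carrier G" "V \<in> carrier G" "M \<in> carrier G" "P \<in> carrier G" "Q \<in> carrier G"
    using a b d e m by (simp_all add: U_def V_def M_def P_def Q_def)
  have hU: "h U = S.w u" and hV: "h V = S.w v"
    using a b d e by (simp_all add: U_def V_def S.w_def)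
  have hP: "h P = x (- (u\<^sup>2))" and hQ: "h Q = x (- (v\<^sup>2))"
    using cl m uv by (simp_all add: P_def Q_def hU hV hm S.w_y H.m_assoc)
  have hM: "h M = inv\<^bsub>H\<^esub> S.w 1"
  proof -
    have "- u + - v = - 1" using uv(3) by (simp add: algebra_simps add_eq_0_iff2)
    then have "x (- u) \<otimes>\<^bsub>H\<^esub> x (- v) = x (- 1)" by (metis S.x_add)
    moreover have "h M = y 1 \<otimes>\<^bsub>H\<^esub> (x (- u) \<otimes>\<^bsub>H\<^esub> x (- v)) \<otimes>\<^bsub>H\<^esub> y 1"
      using a b m by (simp add: M_def hm S.inv_x H.m_assoc)
    ultimately show ?thesis using S.w_braid[of "- 1"] by (simp add: S.inv_w)
  qed
  have hPQ: "h (P \<otimes> a) = h (Q \<otimes> b)"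
  proof -
    have "v = 1 - u" using uv(3) by (simp add: eq_diff_eq add.commute)
    have "- (u\<^sup>2) + u = - (v\<^sup>2) + v"
      unfolding \<open>v = 1 - u\<close> by (simp add: power2_eq_square algebra_simps)
    then show ?thesis using cl a b hP hQ by (simp add: S.x_add[symmetric])
  qed
  have Um: "FR_close G (kernel G H h) 2 (commutator G (U \<otimes> U) m) \<one>"
    unfolding m_def
    by (rule close_commutator_central)
      (use cl k q uv in \<open>simp_all add: hU S.w_square_commutes_tor S.w_square_commutes_y\<close>)
  have Vm: "FR_close G (kernel G H h) 2 (commutator G (V \<otimes> V) m) \<one>"
    unfolding m_def
    by (rule close_commutator_central)
      (use cl k q uv in \<open>simp_all add: hV S.w_square_commutes_tor S.w_square_commutes_y\<close>)
  have "FR_close G (kernel G H h) 21 (commutator G (U \<otimes> M) (V \<otimes> M)) \<one>"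
    by (rule close_palindromes[OF a(1) b(1) e(1) d(1) m U_def V_def M_def P_def Q_def hPQ Um Vm
          b_comm[OF a] d_comm[OF e] a_comm[OF cl(4) hP] b_comm[OF cl(5) hQ]])
  moreover have "h (U \<otimes> M) = S.tor u" "h (V \<otimes> M) = S.tor v"
    using cl by (simp_all add: hU hV hM S.tor_def)
  ultimately show ?thesis using cl by blast
qed

section \<open>Overcommutation from a presentation\<close>

lemma free_group_hom_eq:
  assumes "group G" "\<phi> \<in> hom (free_group S) G" "\<psi> \<in> hom (free_group S) G"
    and eq: "\<And>a. a \<in> S \<Longrightarrow> \<phi> [(a, True)] = \<psi> [(a, True)]"
    and ws: "ws \<in> carrier (free_group S)"
  shows "\<phi> ws = \<psi> ws"
proof -
  interpret F: group "free_group S" by (rule group_free_group)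
  interpret \<phi>: group_hom "free_group S" G \<phi>
    using assms by (simp add: group_hom_def group_hom_axioms_def group_free_group)
  interpret \<psi>: group_hom "free_group S" G \<psi>
    using assms by (simp add: group_hom_def group_hom_axioms_def group_free_group)
  have letter: "\<phi> [x] = \<psi> [x]" "[x] \<in> carrier (free_group S)" if "fst x \<in> S" for x
  proof -
    obtain a s where x: "x = (a, s)" by fastforce
    have a: "a \<in> S" using that x by simp
    show x_in: "[x] \<in> carrier (free_group S)"
      using that by (simp add: free_group_def reduced_Cons)
    show "\<phi> [x] = \<psi> [x]"
    proof (cases s)
      case False
      have "[x] \<otimes>\<^bsub>free_group S\<^esub> [(a, True)] = \<one>\<^bsub>free_group S\<^esub>"
        using False x by (simp add: free_group_def inv_letter_def)
      then have "[x] = inv\<^bsub>free_group S\<^esub> [(a, True)]"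
        using F.inv_equality generator_in_free_group[OF a] x_in by metis
      then show ?thesis using eq[OF a] generator_in_free_group[OF a] by simp
    qed (use x eq a in simp)
  qed
  show ?thesis using ws
  proof (induction ws)
    case Nil
    then show ?case using \<phi>.hom_one \<psi>.hom_one by (simp add: free_group_def)
  next
    case (Cons x xs)
    then have x: "fst x \<in> S" and xs: "xs \<in> carrier (free_group S)"
      by (auto simp: free_group_def reduced_Cons)
    have "x # xs = [x] \<otimes>\<^bsub>free_group S\<^esub> xs"
      using Cons.prems by (cases xs) (auto simp: free_group_def reduced_Cons)
    then show ?case using letter[OF x] xs Cons.IH[OF xs] by simp
  qed
qed

text \<open>The central extensions in the conclusion live on the arbitrary type \<open>'e\<close>.  The local fact
  \<open>commute\<close> is used for the quotient itself and for the lift of the quotient map to an extension.\<close>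

lemma overcommute_if_close:
  assumes R: "R \<lhd> free_group S"
    and a: "a \<in> carrier (free_group S)" and b: "b \<in> carrier (free_group S)"
    and close: "FR_close (free_group S) R n (commutator (free_group S) a b) \<one>\<^bsub>free_group S\<^esub>"
  shows "overcommute TYPE('e) (free_group S Mod R) (R #>\<^bsub>free_group S\<^esub> a) (R #>\<^bsub>free_group S\<^esub> b)"
proof -
  let ?F = "free_group S" and ?G = "free_group S Mod R"
  define \<pi> where "\<pi> w = R #>\<^bsub>?F\<^esub> w" for w
  interpret R: normal R ?F by (rule R)
  interpret \<pi>: group_hom ?F ?G \<pi>
    using R.r_coset_hom_Mod R.factorgroup_is_group
    by (simp add: group_hom_def group_hom_axioms_def group_free_group \<pi>_def[abs_def])
  have \<pi>_R: "\<pi> r = \<one>\<^bsub>?G\<^esub>" if "r \<in> R" for r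
    using that R.rcos_const by (simp add: \<pi>_def FactGroup_def)
  obtain cs where cs: "set cs \<subseteq> FR_commutators ?F R"
    "commutator ?F a b = foldr (mult ?F) cs \<one>\<^bsub>?F\<^esub>"
    using close unfolding FR_close_def
    by (metis R.FR_commutators_closed R.foldr_mult_closed R.r_one subset_trans)
  \<comment> \<open>Every homomorphism that maps \<open>R\<close> to central elements kills the commutators with relators.\<close>
  have commute: "\<psi> a \<otimes>\<^bsub>K\<^esub> \<psi> b = \<psi> b \<otimes>\<^bsub>K\<^esub> \<psi> a"
    if "group K" "\<psi> \<in> hom ?F K"
      and central: "\<And>f r. f \<in> carrier ?F \<Longrightarrow> r \<in> R \<Longrightarrow> \<psi> r \<otimes>\<^bsub>K\<^esub> \<psi> f = \<psi> f \<otimes>\<^bsub>K\<^esub> \<psi> r"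
    for K :: "'x monoid" and \<psi>
  proof -
    interpret \<psi>: group_hom ?F K \<psi>
      using that by (simp add: group_hom_def group_hom_axioms_def group_free_group)
    have triv: "\<psi> (commutator ?F f r) = \<one>\<^bsub>K\<^esub>" if "f \<in> carrier ?F" "r \<in> carrier ?F"
      "\<psi> r \<otimes>\<^bsub>K\<^esub> \<psi> f = \<psi> f \<otimes>\<^bsub>K\<^esub> \<psi> r" for f r
      using \<psi>.commutator_in_kernel[OF that(1,2)] that(3) by (simp add: kernel_def)
    have gen: "\<psi> c = \<one>\<^bsub>K\<^esub>" if c: "c \<in> FR_commutators ?F R" for c
    proof -
      obtain f r where "f \<in> carrier ?F" "r \<in> R"
        "c = commutator ?F f r \<or> c = inv\<^bsub>?F\<^esub> (commutator ?F f r)"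
        using c by (auto simp: FR_commutators_def)
      moreover from this have "r \<in> carrier ?F" by auto
      ultimately show ?thesis using triv[of f r] central[of f r] by auto
    qed
    have "\<psi> (foldr (mult ?F) cs \<one>\<^bsub>?F\<^esub>) = \<one>\<^bsub>K\<^esub>"
      using cs(1)
    proof (induction cs)
      case (Cons c cs)
      then have "c \<in> carrier ?F" "foldr (mult ?F) cs \<one>\<^bsub>?F\<^esub> \<in> carrier ?F"
        using R.FR_commutators_closed by (auto intro!: R.foldr_mult_closed)
      with Cons show ?case using gen by simp
    qed simp
    then have "\<psi> (commutator ?F a b) = \<one>\<^bsub>K\<^esub>" unfolding cs(2) .
    then have "\<psi> (commutator ?F a b \<otimes>\<^bsub>?F\<^esub> (b \<otimes>\<^bsub>?F\<^esub> a)) = \<psi> (b \<otimes>\<^bsub>?F\<^esub> a)"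
      using a b by simp
    moreover have "commutator ?F a b \<otimes>\<^bsub>?F\<^esub> (b \<otimes>\<^bsub>?F\<^esub> a) = a \<otimes>\<^bsub>?F\<^esub> b"
      using a b by (simp add: commutator_def R.word_simps)
    ultimately show ?thesis using a b by simp
  qed
  have "\<pi> a \<otimes>\<^bsub>?G\<^esub> \<pi> b = \<pi> b \<otimes>\<^bsub>?G\<^esub> \<pi> a"
    by (rule commute[OF \<pi>.H.group_axioms \<pi>.homh])
      (metis \<pi>_R \<pi>.H.l_one \<pi>.H.r_one \<pi>.hom_closed)
  moreover have "c \<otimes>\<^bsub>E\<^esub> d = d \<otimes>\<^bsub>E\<^esub> c"
    if ext: "central_extension E ?G p" and cd: "c \<in> carrier E" "d \<in> carrier E" "p c = \<pi> a" "p d = \<pi> b"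
    for E :: "'e monoid" and p c d
  proof -
    have p: "p \<in> hom E ?G" "p ` carrier E = carrier ?G" "group E"
      using ext by (auto simp: central_extension_def epi_def)
    have central: "z \<otimes>\<^bsub>E\<^esub> e = e \<otimes>\<^bsub>E\<^esub> z" if "z \<in> kernel E ?G p" "e \<in> carrier E" for z e
      using ext that by (auto simp: central_extension_def)
    interpret p: group_hom E ?G p
      using p \<pi>.H.group_axioms by (simp add: group_hom_def group_hom_axioms_def)
    have "\<exists>e\<in>carrier E. p e = \<pi> [(s, True)]" if "s \<in> S" for s
      using p(2) \<pi>.hom_closed[OF generator_in_free_group[OF that]] by (metis imageE)
    then obtain f where f: "\<And>s. s \<in> S \<Longrightarrow> f s \<in> carrier E \<and> p (f s) = \<pi> [(s, True)]"
      by metis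
    obtain \<phi> where \<phi>: "\<phi> \<in> hom ?F E" "\<And>s. s \<in> S \<Longrightarrow> \<phi> [(s, True)] = f s"
      using free_group_hom_exists[OF p(3), of f S] f by auto
    interpret \<phi>: group_hom ?F E \<phi>
      using \<phi> p(3) by (simp add: group_hom_def group_hom_axioms_def group_free_group)
    have p\<phi>: "p (\<phi> w) = \<pi> w" if "w \<in> carrier ?F" for w
      using free_group_hom_eq[OF \<pi>.H.group_axioms hom_compose[OF \<phi>(1) p(1)] \<pi>.homh _ that]
        \<phi>(2) f by simp
    have comm: "\<phi> a \<otimes>\<^bsub>E\<^esub> \<phi> b = \<phi> b \<otimes>\<^bsub>E\<^esub> \<phi> a"
    proof (rule commute[OF p(3) \<phi>(1)])
      fix g r assume "g \<in> carrier ?F" "r \<in> R"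
      moreover from this have "r \<in> carrier ?F" by auto
      ultimately show "\<phi> r \<otimes>\<^bsub>E\<^esub> \<phi> g = \<phi> g \<otimes>\<^bsub>E\<^esub> \<phi> r"
        by (intro central p.kernelI) (simp_all add: p\<phi> \<pi>_R)
    qed
    obtain z where z: "z \<in> kernel E ?G p" "c = \<phi> a \<otimes>\<^bsub>E\<^esub> z"
      by (rule p.eq_mult_kernel[of c "\<phi> a"]) (use cd a p\<phi> in auto)
    obtain z' where z': "z' \<in> kernel E ?G p" "d = \<phi> b \<otimes>\<^bsub>E\<^esub> z'"
      by (rule p.eq_mult_kernel[of d "\<phi> b"]) (use cd b p\<phi> in auto)
    have zc: "z \<in> carrier E" "z' \<in> carrier E" using z z' by (auto simp: kernel_def)
    have \<phi>c: "\<phi> a \<in> carrier E" "\<phi> b \<in> carrier E" using a b by auto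
    have "c \<otimes>\<^bsub>E\<^esub> d = \<phi> a \<otimes>\<^bsub>E\<^esub> (z \<otimes>\<^bsub>E\<^esub> d)"
      using z(2) zc \<phi>c cd by (simp add: p.m_assoc)
    also have "\<dots> = \<phi> a \<otimes>\<^bsub>E\<^esub> \<phi> b \<otimes>\<^bsub>E\<^esub> (z' \<otimes>\<^bsub>E\<^esub> z)"
      using central[OF z(1) cd(2)] z'(2) zc \<phi>c by (simp add: p.m_assoc)
    also have "\<dots> = \<phi> b \<otimes>\<^bsub>E\<^esub> (\<phi> a \<otimes>\<^bsub>E\<^esub> z \<otimes>\<^bsub>E\<^esub> z')"
      using comm central[OF z'(1), of z] zc \<phi>c by (simp add: p.m_assoc)
    also have "\<dots> = \<phi> b \<otimes>\<^bsub>E\<^esub> (z' \<otimes>\<^bsub>E\<^esub> c)"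
      using central[OF z'(1) cd(1)] z(2) by simp
    also have "\<dots> = d \<otimes>\<^bsub>E\<^esub> c" using z'(2) zc \<phi>c cd by (simp add: p.m_assoc)
    finally show ?thesis .
  qed
  ultimately show ?thesis
    unfolding overcommute_def using a b \<pi>.hom_closed by (auto simp: \<pi>_def)
qed

lemma ocl_le_if_close:
  assumes "group F" "a \<in> g" "b \<in> h" "FR_close F R n (commutator F a b) \<one>\<^bsub>F\<^esub>"
    and "FR_commutators F R \<subseteq> carrier F"
  shows "ocl F R g h \<le> enat n"
proof -
  interpret group F by fact
  obtain cs where cs: "length cs = n" "set cs \<subseteq> FR_commutators F R"
    "commutator F a b = foldr (mult F) cs \<one>\<^bsub>F\<^esub>"
    using assms(4,5) unfolding FR_close_def by (metis foldr_mult_closed r_one subset_trans)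
  show ?thesis
    unfolding ocl_def
    by (rule INF_lower2[OF assms(2)], rule INF_lower2[OF assms(3)], rule Inf_lower)
      (use cs in blast)
qed


section \<open>The presentation of the Steinberg group\<close>

text \<open>The projection of the free group to \<open>St\<^sub>2\<close>.\<close>

definition st_proj :: "(int \<times> 'k::field) word \<Rightarrow> (int \<times> 'k) word set" where
  "st_proj f = steinberg_R #>\<^bsub>steinberg_free\<^esub> f"

lemma group_hom_st_proj: "group_hom steinberg_free St2 (st_proj :: (int \<times> 'k::field) word \<Rightarrow> _)"
  unfolding group_hom_def group_hom_axioms_def
proof (intro conjI group_St2)
  show "group (steinberg_free :: (int \<times> 'k) word monoid)"
    by (simp add: steinberg_free_def group_free_group)
  show "(st_proj :: (int \<times> 'k) word \<Rightarrow> _) \<in> hom steinberg_free St2"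
    unfolding St2_def st_proj_def[abs_def]
    by (rule normal.r_coset_hom_Mod[OF steinberg_R_normal])
qed

lemma st_proj_eq_one_iff:
  assumes "f \<in> carrier steinberg_free"
  shows "st_proj f = \<one>\<^bsub>St2\<^esub> \<longleftrightarrow> f \<in> steinberg_R"
proof -
  interpret normal "steinberg_R" "steinberg_free" by (rule steinberg_R_normal)
  have "st_proj f = \<one>\<^bsub>St2\<^esub> \<longleftrightarrow> steinberg_R #>\<^bsub>steinberg_free\<^esub> f = steinberg_R"
    by (simp add: st_proj_def St2_def FactGroup_def)
  then show ?thesis
    using assms coset_join1[OF _ assms subgroup_axioms] coset_join2[OF assms subgroup_axioms]
    by blast
qed

lemma kernel_st_proj: "kernel steinberg_free St2 st_proj = steinberg_R"
proof -
  interpret normal "steinberg_R" "steinberg_free" by (rule steinberg_R_normal)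
  show ?thesis using st_proj_eq_one_iff subset by (auto simp: kernel_def)
qed

lemma st_proj_relator: "r \<in> steinberg_relators \<Longrightarrow> st_proj r = \<one>\<^bsub>St2\<^esub>"
proof -
  assume r: "r \<in> steinberg_relators"
  interpret normal "steinberg_R" "steinberg_free" by (rule steinberg_R_normal)
  have "r \<in> steinberg_R"
    using r by (auto simp: steinberg_R_def normal_closure_def)
  then show ?thesis using st_proj_eq_one_iff[of r] by auto
qed

lemma steinberg_pair_St2:
  assumes \<alpha>: "\<alpha> \<in> {1, -1}"
  shows "steinberg_pair St2 (\<lambda>t::'k::field. st_proj (x_word \<alpha> t)) (\<lambda>t. st_proj (x_word (- \<alpha>) t))"
proof -
  interpret group_hom steinberg_free St2 "st_proj :: (int \<times> 'k::field) word \<Rightarrow> _"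
    by (rule group_hom_st_proj)
  have m\<alpha>: "- \<alpha> \<in> {1, -1}" using \<alpha> by auto
  have x_in [simp]: "x_word \<beta> t \<in> carrier steinberg_free" if "\<beta> \<in> {1, -1}" for \<beta> and t :: 'k
    using that by (rule steinberg_word_closed)
  have add: "st_proj (x_word \<beta> (s + t)) = st_proj (x_word \<beta> s) \<otimes>\<^bsub>St2\<^esub> st_proj (x_word \<beta> t)"
    if "\<beta> \<in> {1, -1}" for \<beta> and s t :: 'k
  proof -
    note [simp] = x_in[OF that]
    let ?X = "\<lambda>t. st_proj (x_word \<beta> t)"
    have "x_word \<beta> (t + s) \<otimes>\<^bsub>steinberg_free\<^esub> inv\<^bsub>steinberg_free\<^esub> (x_word \<beta> t)
        \<otimes>\<^bsub>steinberg_free\<^esub> inv\<^bsub>steinberg_free\<^esub> (x_word \<beta> s) \<in> steinberg_relators"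
      unfolding steinberg_relators_def using that by blast
    from st_proj_relator[OF this]
    have rel: "?X (t + s) \<otimes>\<^bsub>St2\<^esub> inv\<^bsub>St2\<^esub> ?X t \<otimes>\<^bsub>St2\<^esub> inv\<^bsub>St2\<^esub> ?X s = \<one>\<^bsub>St2\<^esub>"
      by simp
    have "?X (t + s) = (?X (t + s) \<otimes>\<^bsub>St2\<^esub> inv\<^bsub>St2\<^esub> ?X t \<otimes>\<^bsub>St2\<^esub> inv\<^bsub>St2\<^esub> ?X s)
        \<otimes>\<^bsub>St2\<^esub> (?X s \<otimes>\<^bsub>St2\<^esub> ?X t)"
      by (simp add: H.word_simps)
    then have "?X (s + t) = ?X s \<otimes>\<^bsub>St2\<^esub> ?X t"
      unfolding rel by (simp add: add.commute)
    then show ?thesis by simp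
  qed
  show ?thesis
  proof
    fix c t :: 'k assume c: "c \<noteq> 0"
    note [simp] = x_in[OF \<alpha>] x_in[OF m\<alpha>]
    let ?X = "\<lambda>t. st_proj (x_word \<alpha> t)" and ?Y = "\<lambda>t. st_proj (x_word (- \<alpha>) t)"
    let ?W = "?X c \<otimes>\<^bsub>St2\<^esub> ?Y (- inverse c) \<otimes>\<^bsub>St2\<^esub> ?X c"
    have Y: "inv\<^bsub>St2\<^esub> ?Y s = ?Y (- s)" for s :: 'k
    proof -
      have "?Y (0::'k) = \<one>\<^bsub>St2\<^esub>" using add[OF m\<alpha>, of 0 0] by simp
      then show ?thesis by (intro H.inv_equality) (simp_all add: add[OF m\<alpha>, symmetric])
    qed
    have "w_word \<alpha> c \<otimes>\<^bsub>steinberg_free\<^esub> x_word \<alpha> t \<otimes>\<^bsub>steinberg_free\<^esub> inv\<^bsub>steinberg_free\<^esub> (w_word \<alpha> c)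
        \<otimes>\<^bsub>steinberg_free\<^esub> x_word (- \<alpha>) (inverse (c\<^sup>2) * t) \<in> steinberg_relators"
      unfolding steinberg_relators_def using \<alpha> c by blast
    from st_proj_relator[OF this]
    have "?W \<otimes>\<^bsub>St2\<^esub> ?X t \<otimes>\<^bsub>St2\<^esub> inv\<^bsub>St2\<^esub> ?W \<otimes>\<^bsub>St2\<^esub> ?Y (inverse (c\<^sup>2) * t) = \<one>\<^bsub>St2\<^esub>"
      by (simp add: w_word_def)
    then have "inv\<^bsub>St2\<^esub> ?Y (inverse (c\<^sup>2) * t) = ?W \<otimes>\<^bsub>St2\<^esub> ?X t \<otimes>\<^bsub>St2\<^esub> inv\<^bsub>St2\<^esub> ?W"
      by (intro H.inv_equality) simp_all
    then have "?W \<otimes>\<^bsub>St2\<^esub> ?X t \<otimes>\<^bsub>St2\<^esub> inv\<^bsub>St2\<^esub> ?W = ?Y (- (t / c\<^sup>2))"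
      unfolding Y by (simp add: divide_inverse mult.commute)
    then have "?Y (- (t / c\<^sup>2)) \<otimes>\<^bsub>St2\<^esub> ?W = ?W \<otimes>\<^bsub>St2\<^esub> ?X t \<otimes>\<^bsub>St2\<^esub> inv\<^bsub>St2\<^esub> ?W \<otimes>\<^bsub>St2\<^esub> ?W"
      by simp
    also have "\<dots> = ?W \<otimes>\<^bsub>St2\<^esub> ?X t" by (simp add: H.m_assoc)
    finally show "?W \<otimes>\<^bsub>St2\<^esub> ?X t = ?Y (- (t / c\<^sup>2)) \<otimes>\<^bsub>St2\<^esub> ?W" by simp
  qed (simp_all add: add[OF \<alpha>] add[OF m\<alpha>] x_in[OF \<alpha>] x_in[OF m\<alpha>])
qed

theorem steinberg_torus_overcommute:
  fixes c u v :: "'k::field"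
  assumes \<alpha>: "\<alpha> \<in> {1, -1}" and c: "c\<^sup>2 = 2" "c \<noteq> 0" and three: "(3::'k) \<noteq> 0"
    and uv: "u \<noteq> 0" "v \<noteq> 0" "u + v = 1"
  shows "overcommute TYPE('e) St2 (h_elt \<alpha> u) (h_elt \<alpha> v)"
    "ocl steinberg_free steinberg_R (h_elt \<alpha> u) (h_elt \<alpha> v) \<le> 21"
proof -
  interpret group_hom steinberg_free St2 "st_proj :: (int \<times> 'k::field) word \<Rightarrow> _"
    by (rule group_hom_st_proj)
  interpret R: normal "steinberg_R :: (int \<times> 'k) word set" "steinberg_free" by (rule steinberg_R_normal)
  interpret P: steinberg_pair St2 "\<lambda>t::'k. st_proj (x_word \<alpha> t)" "\<lambda>t. st_proj (x_word (- \<alpha>) t)"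
    by (rule steinberg_pair_St2[OF \<alpha>])
  have "carrier St2 \<subseteq> (st_proj :: (int \<times> 'k) word \<Rightarrow> _) ` carrier steinberg_free"
    by (auto simp: St2_def FactGroup_def RCOSETS_def st_proj_def)
  from ex_close_torus_lifts[OF P.steinberg_pair_axioms this c three uv]
  obtain a b where ab: "a \<in> carrier steinberg_free" "b \<in> carrier steinberg_free"
    "st_proj a = P.tor u" "st_proj b = P.tor v"
    "FR_close steinberg_free steinberg_R 21 (commutator steinberg_free a b) \<one>\<^bsub>steinberg_free\<^esub>"
    unfolding kernel_st_proj by blast
  have m\<alpha>: "- \<alpha> \<in> {1, -1}" using \<alpha> by auto
  have tor: "P.tor t = h_elt \<alpha> t" for t
    using steinberg_word_closed(1)[OF \<alpha>, where ?'a = 'k] steinberg_word_closed(1)[OF m\<alpha>, where ?'a = 'k]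
    by (simp add: P.tor_def P.w_def h_elt_def st_proj_def[symmetric] h_word_def w_word_def)
  have lifts: "h_elt \<alpha> u = steinberg_R #>\<^bsub>steinberg_free\<^esub> a"
    "h_elt \<alpha> v = steinberg_R #>\<^bsub>steinberg_free\<^esub> b"
    using ab(3,4)[unfolded tor, unfolded st_proj_def, symmetric] by simp_all
  show "overcommute TYPE('e) St2 (h_elt \<alpha> u) (h_elt \<alpha> v)"
    using overcommute_if_close[OF R.normal_axioms[unfolded steinberg_free_def]
        ab(1,2,5)[unfolded steinberg_free_def], where ?'e = 'e]
    unfolding lifts St2_def steinberg_free_def .
  have "a \<in> h_elt \<alpha> u" "b \<in> h_elt \<alpha> v"
    unfolding lifts using ab(1,2) G.rcos_self[OF _ R.subgroup_axioms] by simp_all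
  from ocl_le_if_close[OF G.group_axioms this ab(5) R.FR_commutators_closed]
  show "ocl steinberg_free steinberg_R (h_elt \<alpha> u) (h_elt \<alpha> v) \<le> 21"
    by (simp add: numeral_eq_enat)
qed


section \<open>The field of rational functions\<close>

text \<open>The square root of 2.\<close>

lift_definition root2 :: qsqrt2 is "sqrt 2"
  by (rule exI[of _ 0], rule exI[of _ 1]) simp

lemma root2_squared: "root2 * root2 = 1 + 1"
  by transfer simp

lemma qsqrt2_three_nonzero: "(1 + 1 + 1 :: qsqrt2) \<noteq> 0"
  by transfer simp

lemma ratfun_root2: "(Fract [:root2:] 1 :: ratfun)\<^sup>2 = 2"
proof -
  have "(2::ratfun) = 1 + 1" by simp
  also have "\<dots> = Fract [:1 + 1:] 1" by (simp add: One_fract_def one_pCons)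
  finally show ?thesis by (simp add: power2_eq_square root2_squared)
qed

lemma ratfun_root2_nonzero: "(Fract [:root2:] 1 :: ratfun) \<noteq> 0"
proof -
  have "root2 \<noteq> 0" by transfer simp
  then show ?thesis by (simp add: Zero_fract_def eq_fract)
qed

lemma ratfun_three_nonzero: "(3::ratfun) \<noteq> 0"
proof -
  have "(3::ratfun) = 1 + 1 + 1" by simp
  also have "\<dots> = Fract [:1 + 1 + 1:] 1" by (simp add: One_fract_def one_pCons)
  finally have three: "(3::ratfun) = Fract [:1 + 1 + 1:] 1" .
  show ?thesis
    unfolding three Zero_fract_def using qsqrt2_three_nonzero by (simp add: eq_fract)
qed

lemma indet_nonzero: "indet \<noteq> 0" and indet_neq_one: "indet \<noteq> 1"
  by (simp_all add: indet_def Zero_fract_def One_fract_def eq_fract one_pCons)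

theorem mainTheorem6:
  fixes \<alpha> :: int and u v :: ratfun
  assumes "\<alpha> \<in> {1, -1}"
    and "u = indet"
    and "v = 1 - u"
  shows "overcommute TYPE('e) St2 (h_elt \<alpha> u) (h_elt \<alpha> v) \<and>
    ocl steinberg_free steinberg_R (h_elt \<alpha> u) (h_elt \<alpha> v) \<le> 25"
proof -
  have "u \<noteq> 0" "v \<noteq> 0" "u + v = 1"
    using assms(2,3) indet_nonzero indet_neq_one by auto
  note * = steinberg_torus_overcommute[OF assms(1) ratfun_root2 ratfun_root2_nonzero
      ratfun_three_nonzero this]
  have "ocl steinberg_free steinberg_R (h_elt \<alpha> u) (h_elt \<alpha> v) \<le> 25"
    by (rule order_trans[OF *(2)]) (simp add: numeral_eq_enat)
  with *(1) show ?thesis by blast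
qed

end
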